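(* Let $k\in[0,1)$ and $K:=(1+k)/(1-k)$. Let $f:\mathbb{D}\to\mathbb{C}$ be holomorphic, where $\mathbb{D}:=\{z\in\mathbb{C}:|z|<1\}$. Suppose that $f(0)=0$ and $f'(0)\ne0$. If there exists a closed disk $B\subset\mathbb{C}\setminus\{0\}$ such that $\max_{w,z\in B}\sqrt{|w/z|}\le K$ and $$\frac{zf'(z)}{f(z)}\in B\quad\text{for all } z\in\mathbb{D}\setminus\{0\},$$ then $f$ has a $k$-quasiconformal extension to $\overline{\mathbb{C}}$ with a fixed point at $\infty$.
   Context: $\overline{\mathbb{C}}=\mathbb{C}\cup\{\infty\}$. A $k$-quasiconformal map is an orientation-preserving homeomorphism $F$ with distributional derivatives $\partial_zF,\partial_{\bar z}F\in L^1_{\rm loc}$ satisfying $|\partial_{\bar z}F|\le k|\partial_zF|$ a.e. (in local coordinates on $\overline{\mathbb{C}}$). A function $f$ on $\mathbb{D}$ has a $k$-quasiconformal extension to $\overline{\mathbb{C}}$ with a fixed point at $\infty$ if there is a $k$-quasiconformal homeomorphism $F:\overline{\mathbb{C}}\to\overline{\mathbb{C}}$ with $F|_{\mathbb{D}}=f$ and $F(\infty)=\infty$. *)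

theory Defs
  imports "HOL-Complex_Analysis.Complex_Analysis"
begin

section \<open>Distributional Wirtinger derivatives on open subsets of the plane\<close>

definition partial_x :: "(complex \<Rightarrow> complex) \<Rightarrow> complex \<Rightarrow> complex" where
  "partial_x \<phi> z = frechet_derivative \<phi> (at z) 1"

definition partial_y :: "(complex \<Rightarrow> complex) \<Rightarrow> complex \<Rightarrow> complex" where
  "partial_y \<phi> z = frechet_derivative \<phi> (at z) \<i>"

definition wirtinger_dz :: "(complex \<Rightarrow> complex) \<Rightarrow> complex \<Rightarrow> complex" where
  "wirtinger_dz \<phi> z = (partial_x \<phi> z - \<i> * partial_y \<phi> z) / 2"

definition wirtinger_dzbar :: "(complex \<Rightarrow> complex) \<Rightarrow> complex \<Rightarrow> complex" where
  "wirtinger_dzbar \<phi> z = (partial_x \<phi> z + \<i> * partial_y \<phi> z) / 2"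

text \<open>Differentiability is meant over the reals.\<close>

fun Cn_smooth :: "nat \<Rightarrow> (complex \<Rightarrow> complex) \<Rightarrow> bool" where
  "Cn_smooth 0 \<phi> \<longleftrightarrow> continuous_on UNIV \<phi>"
| "Cn_smooth (Suc n) \<phi> \<longleftrightarrow>
     (\<forall>z. \<phi> differentiable (at z)) \<and>
     Cn_smooth n (partial_x \<phi>) \<and> Cn_smooth n (partial_y \<phi>)"

definition test_function_on :: "complex set \<Rightarrow> (complex \<Rightarrow> complex) \<Rightarrow> bool" where
  "test_function_on U \<phi> \<longleftrightarrow>
     (\<forall>n. Cn_smooth n \<phi>) \<and>
     compact (closure {z. \<phi> z \<noteq> 0}) \<and> closure {z. \<phi> z \<noteq> 0} \<subseteq> U"

definition locally_integrable_on :: "(complex \<Rightarrow> complex) \<Rightarrow> complex set \<Rightarrow> bool" where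
  "locally_integrable_on g U \<longleftrightarrow> (\<forall>C. compact C \<and> C \<subseteq> U \<longrightarrow> g absolutely_integrable_on C)"

definition has_distributional_dz :: "(complex \<Rightarrow> complex) \<Rightarrow> (complex \<Rightarrow> complex) \<Rightarrow> complex set \<Rightarrow> bool" where
  "has_distributional_dz g p U \<longleftrightarrow>
     (\<forall>\<phi>. test_function_on U \<phi> \<longrightarrow>
        (LINT z:U|lebesgue. g z * wirtinger_dz \<phi> z) = - (LINT z:U|lebesgue. p z * \<phi> z))"

definition has_distributional_dzbar :: "(complex \<Rightarrow> complex) \<Rightarrow> (complex \<Rightarrow> complex) \<Rightarrow> complex set \<Rightarrow> bool" where
  "has_distributional_dzbar g q U \<longleftrightarrow>
     (\<forall>\<phi>. test_function_on U \<phi> \<longrightarrow>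
        (LINT z:U|lebesgue. g z * wirtinger_dzbar \<phi> z) = - (LINT z:U|lebesgue. q z * \<phi> z))"

definition beltrami_inequality_on :: "real \<Rightarrow> complex set \<Rightarrow> (complex \<Rightarrow> complex) \<Rightarrow> bool" where
  "beltrami_inequality_on k U g \<longleftrightarrow>
     (\<exists>p q. locally_integrable_on p U \<and> locally_integrable_on q U \<and>
            has_distributional_dz g p U \<and> has_distributional_dzbar g q U \<and>
            (AE z in lebesgue. z \<in> U \<longrightarrow> cmod (q z) \<le> k * cmod (p z)))"

text \<open>For an injective continuous map of an open subset of the plane, the winding number below is
  the local degree, which is either 1 or -1.\<close>

definition orientation_preserving_on :: "complex set \<Rightarrow> (complex \<Rightarrow> complex) \<Rightarrow> bool" where
  "orientation_preserving_on U g \<longleftrightarrow>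
     (\<forall>z r. r > 0 \<and> cball z r \<subseteq> U \<longrightarrow> winding_number (g \<circ> circlepath z r) (g z) = 1)"

section \<open>Quasiconformal maps of the Riemann sphere\<close>

text \<open>The Riemann sphere is the one-point compactification of the plane: \<open>Some z\<close> is the finite
  point \<open>z\<close>, and \<open>None\<close> is the point at infinity.\<close>

definition riemann_sphere :: "complex option topology" where
  "riemann_sphere = Alexandroff_compactification euclidean"

text \<open>The two standard coordinates \<open>z\<close> and \<open>1/z\<close>, given by their inverses, which
  parametrize the sphere minus infinity and the sphere minus zero, respectively.\<close>

definition infinity_param :: "complex \<Rightarrow> complex option" where
  "infinity_param z = (if z = 0 then None else Some (1 / z))"

definition sphere_params :: "(complex \<Rightarrow> complex option) set" where
  "sphere_params = {Some, infinity_param}"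

text \<open>The expression of a self-map of the sphere in the coordinates \<open>inv a\<close> on the source and
  \<open>inv b\<close> on the target, together with its natural domain of definition.\<close>

definition local_rep_domain ::
  "(complex \<Rightarrow> complex option) \<Rightarrow> (complex \<Rightarrow> complex option) \<Rightarrow> (complex option \<Rightarrow> complex option) \<Rightarrow> complex set"
  where "local_rep_domain a b F = {z. F (a z) \<in> range b}"

definition local_rep ::
  "(complex \<Rightarrow> complex option) \<Rightarrow> (complex \<Rightarrow> complex option) \<Rightarrow> (complex option \<Rightarrow> complex option) \<Rightarrow> complex \<Rightarrow> complex"
  where "local_rep a b F = inv b \<circ> F \<circ> a"

definition quasiconformal :: "real \<Rightarrow> (complex option \<Rightarrow> complex option) \<Rightarrow> bool" where
  "quasiconformal k F \<longleftrightarrow>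
     homeomorphic_map riemann_sphere riemann_sphere F \<and>
     (\<forall>a\<in>sphere_params. \<forall>b\<in>sphere_params.
        orientation_preserving_on (local_rep_domain a b F) (local_rep a b F) \<and>
        beltrami_inequality_on k (local_rep_domain a b F) (local_rep a b F))"

definition has_qc_extension_fixing_infinity :: "real \<Rightarrow> (complex \<Rightarrow> complex) \<Rightarrow> bool" where
  "has_qc_extension_fixing_infinity k f \<longleftrightarrow>
     (\<exists>F. quasiconformal k F \<and> (\<forall>z\<in>ball 0 1. F (Some z) = Some (f z)) \<and> F None = None)"

end

theory Submission
  imports Defs
begin

text \<open>
  The extension is explicit. If the boundary values of \<open>f\<close> on the unit circle are denoted by \<open>f u\<close>, put
  \<open>F (t * u) = f u * t powr s\<close> for \<open>norm u = 1 \<le> t\<close>, with a suitable complex exponent \<open>s\<close>: every boundary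
  value is carried to infinity along a logarithmic spiral.

  All estimates take place in the logarithmic coordinate \<open>\<zeta> = ln z\<close>. There \<open>f\<close> becomes a map of the left
  half plane that commutes with the translation by \<open>2 * pi * \<i>\<close>, and \<open>z * deriv f z / f z\<close> is its derivative.
  As the derivative has values in a disc \<open>cball c r\<close>, the map differs from \<open>c * \<zeta>\<close> by an \<open>r\<close>-Lipschitz function.
  It thus has Lipschitz boundary values, and all its difference quotients lie in the disc
  (\<open>logarithmic_lift\<close>). The extension is linear with slope \<open>s\<close> in the real part. Its differential at almost
  every point of the right half plane is \<open>v \<mapsto> s * Re v + \<beta> * \<i> * Im v\<close>, where \<open>\<beta>\<close> is in the disc, and so its
  dilatation is the modulus of \<open>(s - \<beta>) / (s + \<beta>)\<close>. The set of \<open>\<beta>\<close> for which this is at most \<open>k\<close> is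
  itself a disc, whose extreme moduli have the ratio \<open>K\<^sup>2\<close>. For the right choice of \<open>s\<close> it contains
  \<open>cball c r\<close> (\<open>disk_apollonius_center\<close>); this is where the square root in the hypothesis comes from.

  The same choice gives \<open>Re (cnj s * \<beta>) > 0\<close> on the disc, which makes the extended map injective
  (\<open>log_ext_inj\<close>). The value \<open>\<beta> = 1\<close> at the origin gives \<open>Re s > 0\<close>, so that the extension tends to infinity at
  infinity (\<open>ext_proper\<close>); invariance of domain then makes it surjective.

  It remains to verify the analytic definition of quasiconformality in the four pairs of coordinates
  of the sphere. In each of them the map has a Lipschitz logarithmic lift that is differentiable almost
  everywhere: the boundary curve is so by Radon-Nikodym and Lebesgue differentiation
  (\<open>lipschitz_complex_differentiable_ae\<close>). Dominated convergence of difference quotients turns the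
  pointwise derivatives into distributional ones (\<open>beltrami_inequality_exp_lift\<close>). The point at infinity
  needs care: near it the map may be merely Hoelder continuous in the coordinate \<open>1 / z\<close>. The orientation is
  determined on the disc where the map is holomorphic and propagates by homotopy
  (\<open>orientation_preserving_onI\<close>).
\<close>

section \<open>Lipschitz functions on the line are differentiable almost everywhere\<close>

text \<open>Adding a large multiple of the identity makes \<open>b\<close> a bi-Lipschitz bijection \<open>F\<close> of the line. The
  image of Lebesgue measure under the inverse of \<open>F\<close> gives \<open>{a..c}\<close> the mass \<open>F c - F a\<close>, and it is
  absolutely continuous because Lipschitz maps preserve null sets. Its Radon-Nikodym density is
  therefore a density for \<open>F\<close>, and subtracting a constant gives one for \<open>b\<close>.\<close>

lemma lipschitz_real_density:
  fixes b :: "real \<Rightarrow> real"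
  assumes lip: "L-lipschitz_on UNIV b"
  obtains D where "\<And>a c. a \<le> c \<Longrightarrow> (D has_integral (b c - b a)) {a..c}"
proof -
  have L: "0 \<le> L" using lip by (rule lipschitz_on_nonneg)
  have lipb: "\<bar>b x - b y\<bar> \<le> L * \<bar>x - y\<bar>" for x y
    using lipschitz_onD[OF lip, of x y] by (simp add: dist_real_def)
  define F where "F = (\<lambda>y. b y + (L + 1) * y)"
  have slope: "y - x \<le> F y - F x" "F y - F x \<le> (2 * L + 1) * (y - x)" if "x \<le> y" for x y
    using lipb[of y x] that by (auto simp: F_def algebra_simps abs_le_iff)
  have inj: "F x = F y \<longleftrightarrow> x = y" for x y
    using slope(1)[of x y] slope(1)[of y x] by (cases "x \<le> y") auto
  have mono: "F x \<le> F y \<longleftrightarrow> x \<le> y" for x y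
    using slope(1)[of x y] slope(1)[of y x] by (cases "x \<le> y") auto
  have contb: "continuous_on A b" for A
    using lip lipschitz_on_continuous_on continuous_on_subset by blast
  have "\<exists>x. F x = y" for y
  proof -
    define x0 where "x0 = y - F 0"
    have "F (- \<bar>x0\<bar>) \<le> y" "y \<le> F \<bar>x0\<bar>"
      using slope(1)[of "- \<bar>x0\<bar>" 0] slope(1)[of 0 "\<bar>x0\<bar>"] by (auto simp: x0_def)
    moreover have "continuous_on {- \<bar>x0\<bar>..\<bar>x0\<bar>} F"
      unfolding F_def by (intro continuous_intros contb)
    ultimately show ?thesis using IVT'[of F "- \<bar>x0\<bar>" y "\<bar>x0\<bar>"] by auto
  qed
  then obtain G where FG: "\<And>y. F (G y) = y" by metis
  then have GF: "G (F x) = x" for x using inj by blast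
  have "1-lipschitz_on UNIV G"
  proof (rule lipschitz_onI)
    fix x y :: real
    show "dist (G x) (G y) \<le> 1 * dist x y"
      using slope(1)[of "G x" "G y"] slope(1)[of "G y" "G x"]
      by (cases "G x \<le> G y") (auto simp: FG dist_real_def)
  qed simp
  then have contG: "continuous_on UNIV G" by (rule lipschitz_on_continuous_on)
  then have measG: "G \<in> measurable lborel lborel"
    by (simp add: borel_measurable_continuous_onI)
  define \<mu> where "\<mu> = distr lborel lborel G"
  have ac: "absolutely_continuous lborel \<mu>"
    unfolding absolutely_continuous_def
  proof
    fix N assume N: "N \<in> null_sets (lborel :: real measure)"
    then have "N \<in> sets lborel" by auto
    have "negligible (F ` N)"
    proof (rule negligible_locally_Lipschitz_image)
      show "negligible N" using N by (metis completion.AE_iff_null_sets negligible_iff_null_sets null_sets_completionI)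
      fix x assume "x \<in> N"
      show "\<exists>T B. open T \<and> x \<in> T \<and> (\<forall>y \<in> N \<inter> T. norm(F y - F x) \<le> B * norm(y - x))"
      proof (intro exI[of _ UNIV] exI[of _ "2*L+1"] conjI ballI)
        fix y show "norm (F y - F x) \<le> (2 * L + 1) * norm (y - x)"
          using slope[of x y] slope[of y x] by (cases "x \<le> y") auto
      qed auto
    qed simp
    moreover have "F ` N = G -` N"
    proof (intro set_eqI iffI)
      fix y assume "y \<in> G -` N"
      then show "y \<in> F ` N" by (intro image_eqI[of y F "G y"]) (auto simp: FG)
    qed (auto simp: GF)
    moreover have "G -` N \<in> sets lborel" using measurable_sets[OF measG \<open>N \<in> sets lborel\<close>] by simp
    ultimately have "emeasure lborel (G -` N) = 0"
      by (metis emeasure_completion negligible_iff_null_sets null_setsD1 sets_completionI_sets main_part)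
    then show "N \<in> null_sets \<mu>"
      using emeasure_distr[OF measG \<open>N \<in> sets lborel\<close>] \<open>N \<in> sets lborel\<close>
      unfolding \<mu>_def null_sets_def by simp
  qed
  obtain f where f: "f \<in> borel_measurable lborel" and dens: "density lborel f = \<mu>"
    using sigma_finite_measure.Radon_Nikodym[OF sigma_finite_lborel ac] by (auto simp: \<mu>_def)
  define D where "D = (\<lambda>x. enn2real (f x))"
  have int: "(D has_integral (F c - F a)) {a..c}" if "a \<le> c" for a c
  proof -
    define h where "h = (\<lambda>x. f x * indicator {a..c} x)"
    have [measurable]: "h \<in> borel_measurable lborel" unfolding h_def using f by measurable
    have "(\<integral>\<^sup>+x. h x \<partial>lborel) = emeasure \<mu> {a..c}"
      unfolding h_def dens[symmetric] using f by (simp add: emeasure_density)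
    also have "\<dots> = emeasure lborel (G -` {a..c})"
      unfolding \<mu>_def using measG by (subst emeasure_distr) auto
    also have "G -` {a..c} = {F a..F c}"
      using mono[of a "G y" for y] mono[of "G y" c for y] by (auto simp: FG)
    also have "emeasure lborel {F a..F c} = ennreal (F c - F a)"
      using slope(1)[OF that] that by simp
    finally have hint: "(\<integral>\<^sup>+x. h x \<partial>lborel) = ennreal (F c - F a)" .
    then have "AE x in lborel. h x \<noteq> \<infinity>"
      by (intro nn_integral_noteq_infinite) auto
    then have eq: "AE x in lborel. ennreal (enn2real (h x)) = h x"
      by eventually_elim (simp add: top.not_eq_extremum)
    have nn: "(\<integral>\<^sup>+x. ennreal (enn2real (h x)) \<partial>lborel) = ennreal (F c - F a)"
      using nn_integral_cong_AE[OF eq] hint by simp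
    have i: "integrable lborel (\<lambda>x. enn2real (h x))"
      by (rule integrableI_nonneg) (auto simp: nn)
    have "integral\<^sup>L lborel (\<lambda>x. enn2real (h x)) = F c - F a"
      using slope(1)[OF that] that by (subst integral_eq_nn_integral) (auto simp: nn)
    with has_integral_integral_lborel[OF i]
    have "((\<lambda>x. enn2real (h x)) has_integral (F c - F a)) UNIV" by simp
    also have "(\<lambda>x. enn2real (h x)) = (\<lambda>x. if x \<in> {a..c} then D x else 0)"
      by (auto simp: h_def D_def)
    finally show ?thesis by (simp only: has_integral_restrict_UNIV)
  qed
  have "((\<lambda>x. D x - (L + 1)) has_integral (b c - b a)) {a..c}" if "a \<le> c" for a c
  proof -
    have "((\<lambda>x. D x - (L + 1)) has_integral (F c - F a) - (c - a) *\<^sub>R (L + 1)) {a..c}"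
      using has_integral_diff[OF int[OF that] has_integral_const_real[of "L + 1" a c]] that by simp
    also have "(F c - F a) - (c - a) *\<^sub>R (L + 1) = b c - b a"
      by (simp add: F_def algebra_simps)
    finally show ?thesis .
  qed
  then show thesis using that by blast
qed

text \<open>Once \<open>b\<close> is an indefinite integral, the Lebesgue differentiation theorem applies. The version
  \<open>integrable_ccontinuous_explicit\<close> averages over intervals to the right of a point only, so the
  derivative from the left is obtained from the reflected density.\<close>

lemma lipschitz_real_differentiable_ae:
  fixes b :: "real \<Rightarrow> real"
  assumes lip: "L-lipschitz_on UNIV b"
  obtains N where "negligible N" "\<And>x. x \<notin> N \<Longrightarrow> \<exists>d. (b has_real_derivative d) (at x)"
proof -
  obtain D where D: "\<And>a c. a \<le> c \<Longrightarrow> (D has_integral (b c - b a)) {a..c}"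
    using lipschitz_real_density[OF lip] by blast
  have D': "((\<lambda>x. D (- x)) has_integral (b (- a) - b (- c))) {a..c}" if "a \<le> c" for a c
    using has_integral_reflect_real[of D "b (- a) - b (- c)" "- a" "- c"] D[of "- c" "- a"] that
    by simp
  have "D integrable_on cbox a c" for a c
    using D[of a c] by (cases "a \<le> c") (auto intro: has_integral_integrable)
  then obtain N1 where N1: "negligible N1"
    "\<And>x e. \<lbrakk>x \<notin> N1; 0 < e\<rbrakk> \<Longrightarrow> \<exists>d>0. \<forall>h. 0 < h \<and> h < d \<longrightarrow>
         norm(integral (cbox x (x + h *\<^sub>R One)) D /\<^sub>R h ^ DIM(real) - D x) < e"
    using integrable_ccontinuous_explicit[of D] by blast
  have "(\<lambda>x. D (- x)) integrable_on cbox a c" for a c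
    using D'[of a c] by (cases "a \<le> c") (auto intro: has_integral_integrable)
  then obtain N2 where N2: "negligible N2"
    "\<And>x e. \<lbrakk>x \<notin> N2; 0 < e\<rbrakk> \<Longrightarrow> \<exists>d>0. \<forall>h. 0 < h \<and> h < d \<longrightarrow>
         norm(integral (cbox x (x + h *\<^sub>R One)) (\<lambda>x. D (- x)) /\<^sub>R h ^ DIM(real) - D (- x)) < e"
    using integrable_ccontinuous_explicit[of "\<lambda>x. D (- x)"] by blast
  show thesis
  proof
    show "negligible (N1 \<union> uminus ` N2)"
      using N1(1) N2(1)
      by (intro negligible_Un negligible_differentiable_image_negligible)
         (auto simp: differentiable_on_def)
    fix x assume x: "x \<notin> N1 \<union> uminus ` N2"
    then have x1: "x \<notin> N1" and x2: "- x \<notin> N2" by (force, force)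
    have "(b has_real_derivative D x) (at x)"
      unfolding DERIV_def LIM_eq
    proof (intro allI impI)
      fix e :: real assume e: "0 < e"
      obtain d1 where d1: "d1 > 0" "\<And>h. 0 < h \<Longrightarrow> h < d1 \<Longrightarrow>
          \<bar>integral {x..x + h} D / h - D x\<bar> < e"
        using N1(2)[OF x1 e] by (auto simp: divide_inverse mult.commute)
      obtain d2 where d2: "d2 > 0" "\<And>h. 0 < h \<Longrightarrow> h < d2 \<Longrightarrow>
          \<bar>integral {- x..- x + h} (\<lambda>x. D (- x)) / h - D x\<bar> < e"
        using N2(2)[OF x2 e] by (auto simp: divide_inverse mult.commute)
      show "\<exists>s>0. \<forall>h. h \<noteq> 0 \<and> norm (h - 0) < s \<longrightarrow> norm ((b (x + h) - b x) / h - D x) < e"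
      proof (intro exI[of _ "min d1 d2"] conjI allI impI)
        fix h :: real assume h: "h \<noteq> 0 \<and> norm (h - 0) < min d1 d2"
        show "norm ((b (x + h) - b x) / h - D x) < e"
        proof (cases "h > 0")
          case True
          then show ?thesis using d1(2)[of h] h integral_unique[OF D[of x "x + h"]] by simp
        next
          case False
          then have "integral {- x..- x + - h} (\<lambda>x. D (- x)) = b x - b (x + h)"
            using integral_unique[OF D'[of "- x" "- x + - h"]] by (simp add: add.commute)
          moreover have "(b x - b (x + h)) / - h = (b (x + h) - b x) / h"
            using h by (simp add: field_simps)
          ultimately show ?thesis using d2(2)[of "- h"] h False by simp
        qed
      qed (use d1 d2 in auto)
    qed
    then show "\<exists>d. (b has_real_derivative d) (at x)" by blast
  qed
qed

lemma lipschitz_complex_differentiable_ae: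
  fixes b :: "real \<Rightarrow> complex"
  assumes lip: "L-lipschitz_on UNIV b"
  obtains N where "negligible N" "\<And>x. x \<notin> N \<Longrightarrow> \<exists>d. (b has_vector_derivative d) (at x)"
proof -
  have "L-lipschitz_on UNIV (\<lambda>x. Re (b x))" "L-lipschitz_on UNIV (\<lambda>x. Im (b x))"
    using lip abs_Re_le_cmod abs_Im_le_cmod unfolding lipschitz_on_def dist_norm
    by (metis order_trans minus_complex.simps(1) real_norm_def,
        metis order_trans minus_complex.simps(2) real_norm_def)
  then obtain N1 N2 where
    "negligible N1" "\<And>x. x \<notin> N1 \<Longrightarrow> \<exists>d. ((\<lambda>x. Re (b x)) has_real_derivative d) (at x)"
    "negligible N2" "\<And>x. x \<notin> N2 \<Longrightarrow> \<exists>d. ((\<lambda>x. Im (b x)) has_real_derivative d) (at x)"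
    by (metis lipschitz_real_differentiable_ae)
  note N = this
  show thesis
  proof
    show "negligible (N1 \<union> N2)" using N by (intro negligible_Un)
    fix x assume "x \<notin> N1 \<union> N2"
    then obtain d1 d2 where "((\<lambda>x. Re (b x)) has_real_derivative d1) (at x)"
      "((\<lambda>x. Im (b x)) has_real_derivative d2) (at x)" using N by blast
    then have "(b has_vector_derivative Complex d1 d2) (at x)"
      by (simp add: has_vector_derivative_complex_iff)
    then show "\<exists>d. (b has_vector_derivative d) (at x)" by blast
  qed
qed

section \<open>Integrals of directional derivatives\<close>

text \<open>A directional derivative as a limit along a sequence: the form that dominated convergence and
  measurability of limits need.\<close>

lemma has_derivative_imp_difference_quotients:
  fixes f :: "'a::real_normed_vector \<Rightarrow> 'b::real_normed_vector"
  assumes "(f has_derivative f') (at z)"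
  shows "(\<lambda>n. real (Suc n) *\<^sub>R (f (z + v /\<^sub>R real (Suc n)) - f z)) \<longlonglongrightarrow> f' v"
proof -
  have "((\<lambda>t::real. f (z + t *\<^sub>R v)) has_derivative (\<lambda>t. f' (t *\<^sub>R v))) (at 0)"
    by (rule has_derivative_compose[where f = "\<lambda>t. z + t *\<^sub>R v" and g = f])
       (use assms in \<open>auto intro!: derivative_eq_intros\<close>)
  then have "((\<lambda>t::real. f (z + t *\<^sub>R v)) has_vector_derivative f' v) (at 0)"
    using linear_scale[OF has_derivative_linear[OF assms]] by (simp add: has_vector_derivative_def)
  then have "((\<lambda>t. (f (z + t *\<^sub>R v) - f z) /\<^sub>R t) \<longlongrightarrow> f' v) (at 0)"
  proof -
    assume "((\<lambda>t::real. f (z + t *\<^sub>R v)) has_vector_derivative f' v) (at 0)"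
    then have *: "(\<lambda>t. norm (f (z + t *\<^sub>R v) - f z - t *\<^sub>R f' v) / norm t) \<midarrow>0\<rightarrow> 0"
      by (simp add: has_vector_derivative_def has_derivative_at)
    show ?thesis
      unfolding Lim_null[of _ "f' v"] 
    proof (rule tendsto_norm_zero_cancel, rule Lim_transform_eventually[OF *])
      show "\<forall>\<^sub>F t in at 0. norm (f (z + t *\<^sub>R v) - f z - t *\<^sub>R f' v) / norm t
          = norm ((f (z + t *\<^sub>R v) - f z) /\<^sub>R t - f' v)"
        unfolding eventually_at_filter
      proof (intro always_eventually allI impI)
        fix t :: real assume "t \<noteq> 0"
        then have "(f (z + t *\<^sub>R v) - f z) /\<^sub>R t - f' v = (f (z + t *\<^sub>R v) - f z - t *\<^sub>R f' v) /\<^sub>R t"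
          by (simp add: scaleR_diff_right)
        then show "norm (f (z + t *\<^sub>R v) - f z - t *\<^sub>R f' v) / norm t
          = norm ((f (z + t *\<^sub>R v) - f z) /\<^sub>R t - f' v)" by (simp add: divide_inverse mult.commute)
      qed
    qed
  qed
  moreover have "filterlim (\<lambda>n. inverse (real (Suc n))) (at 0) sequentially"
    unfolding filterlim_at using LIMSEQ_inverse_real_of_nat by auto
  ultimately have "((\<lambda>n. (f (z + inverse (real (Suc n)) *\<^sub>R v) - f z) /\<^sub>R inverse (real (Suc n))) \<longlongrightarrow> f' v) sequentially"
    by (rule filterlim_compose)
  then show ?thesis by simp
qed

text \<open>The one place where derivatives meet integrals. The difference quotients of \<open>\<psi>\<close> have integral
  zero by translation invariance, and the Lipschitz constant dominates them, so their almost
  everywhere limit has integral zero too. Applied to a product, this is integration by parts, and no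
  absolute continuity on lines has to be discussed.\<close>

lemma integral_directional_derivative_eq_0:
  fixes \<psi> :: "'a::euclidean_space \<Rightarrow> 'b::euclidean_space"
  assumes lip: "L-lipschitz_on UNIV \<psi>"
    and supp: "\<And>z. R < norm z \<Longrightarrow> \<psi> z = 0"
    and meas: "(\<lambda>z. \<psi>' z v) \<in> borel_measurable lebesgue"
    and der: "AE z in lebesgue. (\<psi> has_derivative \<psi>' z) (at z)"
  shows "(LINT z|lebesgue. \<psi>' z v) = 0"
proof -
  define q where "q = (\<lambda>n z. real (Suc n) *\<^sub>R (\<psi> (z + v /\<^sub>R real (Suc n)) - \<psi> z))"
  define w where "w = (\<lambda>z::'a. (L * norm v) *\<^sub>R indicator (cball 0 (R + norm v)) z :: real)"
  have cont: "continuous_on UNIV \<psi>" using lip by (rule lipschitz_on_continuous_on)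
  have meas_psi: "\<psi> \<in> borel_measurable lborel"
    using cont by (simp add: borel_measurable_continuous_onI)
  have L: "0 \<le> L" using lip by (rule lipschitz_on_nonneg)
  have int_psi: "integrable lborel \<psi>"
  proof -
    obtain M where M: "\<And>z. z \<in> cball 0 R \<Longrightarrow> norm (\<psi> z) \<le> M"
      using compact_imp_bounded[OF compact_continuous_image[OF continuous_on_subset[OF cont subset_UNIV] compact_cball[of 0 R]]]
      unfolding bounded_iff by force
    have "integrable lborel (\<lambda>z::'a. max M 0 *\<^sub>R indicator (cball 0 R) z :: real)"
      using emeasure_lborel_cball_finite[of "0::'a"]
      by (intro integrable_scaleR_right integrable_real_indicator) auto
    then show ?thesis
    proof (rule Bochner_Integration.integrable_bound[OF _ meas_psi], intro always_eventually allI)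
      fix z show "norm (\<psi> z) \<le> norm (max M 0 *\<^sub>R indicator (cball 0 R) z :: real)"
        using M[of z] supp[of z] norm_ge_zero[of "\<psi> z"] by (cases "norm z \<le> R") (auto simp: abs_if simp del: norm_ge_zero)
    qed
  qed
  have shift: "integrable lborel (\<lambda>z. \<psi> (z + c))" "(LINT z|lborel. \<psi> (z + c)) = (LINT z|lborel. \<psi> z)" for c
  proof -
    have "integrable (distr lborel borel ((+) c)) \<psi>" using int_psi by (simp add: lborel_distr_plus)
    then have "integrable lborel (\<lambda>z. \<psi> (c + z))"
      by (subst (asm) integrable_distr_eq) (use meas_psi in auto)
    then show "integrable lborel (\<lambda>z. \<psi> (z + c))" by (simp add: add.commute)
    have "(LINT z|lborel. \<psi> z) = (LINT z|distr lborel borel ((+) c). \<psi> z)" by (simp add: lborel_distr_plus)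
    also have "\<dots> = (LINT z|lborel. \<psi> (c + z))" by (subst integral_distr) (use meas_psi in auto)
    finally show "(LINT z|lborel. \<psi> (z + c)) = (LINT z|lborel. \<psi> z)" by (simp add: add.commute)
  qed
  have meas_q: "q n \<in> borel_measurable lborel" for n
    unfolding q_def by (intro borel_measurable_scaleR borel_measurable_diff meas_psi
        borel_measurable_integrable[OF shift(1)]) auto
  have q0: "(LINT z|lebesgue. q n z) = 0" for n
  proof -
    have "(LINT z|lborel. q n z) = 0"
      unfolding q_def using shift int_psi by (subst integral_scaleR_right) (simp add: Bochner_Integration.integral_diff)
    then show ?thesis using meas_q by (simp add: integral_completion)
  qed
  have "(\<lambda>n. LINT z|lebesgue. q n z) \<longlonglongrightarrow> (LINT z|lebesgue. \<psi>' z v)"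
  proof (rule integral_dominated_convergence[where w = w])
    show "q n \<in> borel_measurable lebesgue" for n using meas_q by (simp add: measurable_completion)
    show "integrable lebesgue w" unfolding w_def
      using emeasure_lborel_cball_finite[of "0::'a"]
      by (intro integrable_scaleR_right integrable_real_indicator) auto
    show "AE z in lebesgue. (\<lambda>n. q n z) \<longlonglongrightarrow> \<psi>' z v"
      using der unfolding q_def by eventually_elim (rule has_derivative_imp_difference_quotients)
    show "AE z in lebesgue. norm (q n z) \<le> w z" for n
    proof (intro always_eventually allI)
      fix z
      show "norm (q n z) \<le> w z"
      proof (cases "norm z \<le> R + norm v")
        case True
        have "norm (\<psi> (z + v /\<^sub>R real (Suc n)) - \<psi> z) \<le> L * norm (v /\<^sub>R real (Suc n))"
          using lipschitz_onD[OF lip, of "z + v /\<^sub>R real (Suc n)" z] by (simp add: dist_norm)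
        then have "norm (q n z) \<le> real (Suc n) * (L * norm (v /\<^sub>R real (Suc n)))"
          unfolding q_def norm_scaleR by (intro mult_mono) auto
        also have "\<dots> = L * norm v" by simp
        finally show ?thesis using True by (simp add: w_def)
      next
        case False
        have "norm (v /\<^sub>R real (Suc n)) \<le> norm v"
          using mult_left_mono[of 1 "1 + real n" "norm v"] by (simp add: divide_simps)
        then have "R < norm (z + v /\<^sub>R real (Suc n))" "R < norm z"
          using False norm_diff_ineq[of z "v /\<^sub>R real (Suc n)"] norm_ge_zero[of v] by linarith+
        then show ?thesis using supp L False by (simp add: q_def w_def)
      qed
    qed
  qed (rule meas)
  then show ?thesis using q0 by (simp add: LIMSEQ_const_iff)
qed

section \<open>Weak derivatives across a point singularity\<close>

text \<open>The dyadic discs \<open>cball 0 (R / 2 ^ n)\<close>, weighted by \<open>2 ^ Suc n / R\<close>, add up to a function that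
  dominates the reciprocal of the norm, and their areas decay like \<open>4\<close> to the power \<open>- n\<close>.\<close>

lemma integrable_inverse_norm_cball:
  "integrable lebesgue (\<lambda>z::complex. indicator (cball 0 R) z / norm z :: real)"
proof (cases "R > 0")
  case True
  define s where "s = (\<lambda>n z::complex. ennreal (2 ^ Suc n / R) * indicator (cball 0 (R / 2 ^ n)) z)"
  have le: "ennreal (norm (indicator (cball 0 R) z / norm z :: real)) \<le> (\<Sum>n. s n z)" for z :: complex
  proof (cases "z = 0 \<or> norm z > R")
    case False
    then have z: "0 < norm z" "norm z \<le> R" by auto
    have "\<exists>n. R / 2 ^ n < norm z"
    proof -
      obtain n where "R / norm z < 2 ^ n" using real_arch_pow[of 2 "R / norm z"] by auto
      then show ?thesis using z by (auto simp: field_simps)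
    qed
    \<comment> \<open>The smallest dyadic disc that contains \<open>z\<close> has index \<open>m - 1\<close> and alone dominates.\<close>
    define m where "m = (LEAST n. R / 2 ^ n < norm z)"
    have m: "R / 2 ^ m < norm z" unfolding m_def by (rule LeastI_ex) fact
    with z have "m \<noteq> 0" by (intro notI) auto
    then obtain n where n: "m = Suc n" using not0_implies_Suc by blast
    then have "\<not> R / 2 ^ n < norm z" using not_less_Least[of n "\<lambda>n. R / 2 ^ n < norm z"] by (simp flip: m_def)
    then have "s n z = ennreal (2 ^ Suc n / R)" by (simp add: s_def)
    moreover have "1 / norm z \<le> 2 ^ Suc n / R" using m z True by (simp add: n field_simps)
    ultimately have "ennreal (1 / norm z) \<le> s n z" by (simp add: ennreal_leI)
    also have "\<dots> \<le> (\<Sum>n. s n z)"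
      using sum_le_suminf[of "\<lambda>n. s n z" "{n}"] by simp
    finally show ?thesis using z by simp
  qed auto
  have [measurable]: "s n \<in> borel_measurable lborel" for n
    unfolding s_def by (intro borel_measurable_times_ennreal borel_measurable_const borel_measurable_indicator) simp
  have "(\<integral>\<^sup>+z. ennreal (norm (indicator (cball 0 R) z / norm (z::complex) :: real)) \<partial>lborel) \<le> (\<integral>\<^sup>+z. (\<Sum>n. s n z) \<partial>lborel)"
    by (intro nn_integral_mono le)
  also have "\<dots> = (\<Sum>n. \<integral>\<^sup>+z. s n z \<partial>lborel)" by (rule nn_integral_suminf) measurable
  also have "\<dots> = (\<Sum>n. ennreal (2 * pi * R * (1 / 2) ^ n))"
  proof (intro suminf_cong)
    fix n
    have "(\<integral>\<^sup>+z. s n z \<partial>lborel) = ennreal (2 ^ Suc n / R) * emeasure lborel (cball (0::complex) (R / 2 ^ n))"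
      unfolding s_def by (rule nn_integral_cmult_indicator) simp
    also have "\<dots> = ennreal (2 ^ Suc n / R) * ennreal (pi * (R / 2 ^ n)\<^sup>2)"
      using True by (subst emeasure_cball) (auto simp: unit_ball_vol_2)
    also have "\<dots> = ennreal (2 * pi * R * (1 / 2) ^ n)"
      using True by (subst ennreal_mult[symmetric]) (auto simp: power2_eq_square field_simps)
    finally show "(\<integral>\<^sup>+z. s n z \<partial>lborel) = ennreal (2 * pi * R * (1 / 2) ^ n)" .
  qed
  also have "\<dots> < \<infinity>"
    using True by (subst suminf_ennreal_eq[OF _ sums_mult[OF geometric_sums]]) auto
  finally have "integrable lborel (\<lambda>z::complex. indicator (cball 0 R) z / norm z :: real)"
    by (intro integrableI_bounded borel_measurable_divide borel_measurable_indicator borel_measurable_norm) auto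
  then show ?thesis by (simp add: integrable_completion borel_measurable_integrable)
next
  case False
  then have "cmod z \<le> R \<Longrightarrow> z = 0" for z
    using norm_le_zero_iff[of z] by linarith
  then have "(\<lambda>z::complex. indicator (cball 0 R) z / norm z :: real) = (\<lambda>z. 0)"
    by (auto simp: indicator_def fun_eq_iff)
  then show ?thesis by simp
qed

lemma test_function_regularity:
  assumes "test_function_on U \<phi>"
  obtains C L where "compact C" "C \<subseteq> U" "0 \<le> L" "L-lipschitz_on UNIV \<phi>"
    "\<And>z. (\<phi> has_derivative frechet_derivative \<phi> (at z)) (at z)"
    "\<And>z v. norm (frechet_derivative \<phi> (at z) v) \<le> L * norm v"
    "\<And>v. continuous_on UNIV (\<lambda>z. frechet_derivative \<phi> (at z) v)"
    "\<And>z. z \<notin> C \<Longrightarrow> \<phi> z = 0" "\<And>z v. z \<notin> C \<Longrightarrow> frechet_derivative \<phi> (at z) v = 0"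
proof -
  define C where "C = closure {z. \<phi> z \<noteq> 0}"
  have C: "compact C" "C \<subseteq> U" and "Cn_smooth (Suc 0) \<phi>"
    using assms by (auto simp: test_function_on_def C_def)
  then have diff: "\<And>z. \<phi> differentiable (at z)"
    and px: "continuous_on UNIV (partial_x \<phi>)" and py: "continuous_on UNIV (partial_y \<phi>)" by auto
  have der: "(\<phi> has_derivative frechet_derivative \<phi> (at z)) (at z)" for z
    using diff by (simp add: frechet_derivative_works)
  have lin: "frechet_derivative \<phi> (at z) v = Re v * partial_x \<phi> z + Im v * partial_y \<phi> z" for z v
  proof -
    interpret bounded_linear "frechet_derivative \<phi> (at z)" using der by (rule has_derivative_bounded_linear)
    have "v = Re v *\<^sub>R 1 + Im v *\<^sub>R \<i>" by (simp add: complex_eq_iff)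
    then show ?thesis unfolding partial_x_def partial_y_def
      by (metis add scaleR scaleR_conv_of_real)
  qed
  have C0: "\<phi> z = 0" if "z \<notin> C" for z
    using that closure_subset[of "{z. \<phi> z \<noteq> 0}"] by (auto simp: C_def)
  have D0: "frechet_derivative \<phi> (at z) v = 0" if "z \<notin> C" for z v
  proof -
    have "(\<phi> has_derivative (\<lambda>_. 0)) (at z)"
      by (rule has_derivative_transform_within_open[where f = "\<lambda>_. 0" and s = "- C"])
         (use that C0 C(1) in \<open>auto intro: compact_imp_closed\<close>)
    then have "frechet_derivative \<phi> (at z) = (\<lambda>_. 0)" by (metis frechet_derivative_at)
    then show ?thesis by simp
  qed
  have bdd: "\<exists>M. \<forall>z. norm (f z) \<le> M" if f: "continuous_on UNIV f" "\<And>z. z \<notin> C \<Longrightarrow> f z = 0"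
    for f :: "complex \<Rightarrow> complex"
  proof -
    obtain M where "\<forall>x\<in>f ` C. norm x \<le> M"
      using compact_imp_bounded[OF compact_continuous_image[OF continuous_on_subset[OF f(1) subset_UNIV] C(1)]]
      unfolding bounded_iff by blast
    then have "norm (f z) \<le> max M 0" for z using f(2)[of z] by (cases "z \<in> C") (auto simp: le_max_iff_disj)
    then show ?thesis by blast
  qed
  obtain M1 M2 where M: "\<And>z. norm (partial_x \<phi> z) \<le> M1" "\<And>z. norm (partial_y \<phi> z) \<le> M2"
    using bdd[OF px] bdd[OF py] D0 by (auto simp: partial_x_def partial_y_def)
  define L where "L = M1 + M2"
  have M0: "0 \<le> M1" "0 \<le> M2" using M[of 0] norm_ge_zero order_trans by blast+
  have bd: "norm (frechet_derivative \<phi> (at z) v) \<le> L * norm v" for z v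
  proof -
    have "norm (frechet_derivative \<phi> (at z) v) \<le> \<bar>Re v\<bar> * norm (partial_x \<phi> z) + \<bar>Im v\<bar> * norm (partial_y \<phi> z)"
      unfolding lin by (rule order_trans[OF norm_triangle_ineq]) (simp add: norm_mult)
    also have "\<dots> \<le> norm v * M1 + norm v * M2"
      using M M0 by (intro add_mono mult_mono) (auto simp: abs_Re_le_cmod abs_Im_le_cmod)
    finally show ?thesis by (simp add: L_def algebra_simps)
  qed
  have "L-lipschitz_on UNIV \<phi>"
  proof (rule lipschitz_onI)
    fix x y
    have "norm (\<phi> x - \<phi> y) \<le> L * norm (x - y)"
      by (rule differentiable_bound[where S = UNIV and f' = "\<lambda>z. frechet_derivative \<phi> (at z)"])
         (use der bd in \<open>auto intro: onorm_bound has_derivative_at_withinI simp: L_def M0\<close>)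
    then show "dist (\<phi> x) (\<phi> y) \<le> L * dist x y" by (simp add: dist_norm)
  qed (simp add: L_def M0)
  moreover have "continuous_on UNIV (\<lambda>z. frechet_derivative \<phi> (at z) v)" for v
    unfolding lin by (intro continuous_intros px py)
  ultimately show thesis using that[of C L] C der bd C0 D0 M0 by (auto simp: L_def)
qed

lemma compact_norm_bound:
  fixes g :: "'a::topological_space \<Rightarrow> 'b::real_normed_vector"
  assumes "continuous_on C g" "compact C"
  obtains M where "0 \<le> M" "\<And>z. z \<in> C \<Longrightarrow> norm (g z) \<le> M"
proof -
  obtain M where "\<forall>x\<in>g ` C. norm x \<le> M"
    using compact_imp_bounded[OF compact_continuous_image[OF assms]] unfolding bounded_iff by blast
  then show thesis by (intro that[of "max M 0"]) (auto simp: le_max_iff_disj)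
qed

text \<open>The values of \<open>g'\<close> on the exceptional set \<open>E\<close> are arbitrary; this does no harm because Lebesgue
  measure is complete.\<close>

lemma directional_derivative_measurable:
  fixes g :: "'a::euclidean_space \<Rightarrow> 'b::euclidean_space"
  assumes U: "open U" and cont: "continuous_on U g" and E: "negligible E"
    and der: "\<And>z. z \<in> U - E \<Longrightarrow> (g has_derivative g' z) (at z)"
  shows "(\<lambda>z. indicator U z *\<^sub>R g' z v) \<in> borel_measurable lebesgue"
proof -
  define G where "G = (\<lambda>z. indicator U z *\<^sub>R g z)"
  have G [measurable]: "G \<in> borel_measurable borel"
    unfolding G_def using U cont by (intro borel_measurable_continuous_on_indicator) auto
  define q where "q = (\<lambda>n z. indicator U z *\<^sub>R (real (Suc n) *\<^sub>R (G (z + v /\<^sub>R real (Suc n)) - G z)))"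
  have [measurable]: "U \<in> sets borel" using U by simp
  have "q n \<in> borel_measurable borel" for n unfolding q_def by measurable
  then have q: "q n \<in> borel_measurable lebesgue" for n by (simp add: measurable_completion)
  have EE: "E \<in> null_sets lebesgue" using E by (simp add: negligible_iff_null_sets)
  then have [measurable]: "E \<in> sets lebesgue" by auto
  have "(\<lambda>z. if z \<in> E then 0 else indicator U z *\<^sub>R g' z v) \<in> borel_measurable lebesgue"
  proof (rule borel_measurable_LIMSEQ_metric)
    show "(\<lambda>z. if z \<in> E then 0 else q n z) \<in> borel_measurable lebesgue" for n
      using q by measurable
    fix z
    show "(\<lambda>n. if z \<in> E then 0 else q n z) \<longlonglongrightarrow> (if z \<in> E then 0 else indicator U z *\<^sub>R g' z v)"
    proof (cases "z \<in> U - E")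
      case True
      then have "(G has_derivative g' z) (at z)"
        by (intro has_derivative_transform_within_open[OF der U]) (auto simp: G_def)
      from has_derivative_imp_difference_quotients[OF this] True show ?thesis by (simp add: q_def)
    qed (auto simp: q_def indicator_def)
  qed
  then show ?thesis
    by (rule borel_measurable_AE) (use AE_not_in[OF EE] in eventually_elim, auto)
qed

lemma singular_derivative_locally_integrable:
  fixes g :: "complex \<Rightarrow> complex"
  assumes U: "open U" and cont: "continuous_on U g" and E: "negligible E"
    and der: "\<And>z. z \<in> U - E \<Longrightarrow> (g has_derivative g' z) (at z)"
    and bd: "\<And>C. compact C \<Longrightarrow> C \<subseteq> U \<Longrightarrow> \<exists>M. \<forall>z\<in>C - E. norm (g' z v) * norm z \<le> M"
  shows "locally_integrable_on (\<lambda>z. g' z v) U"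
  unfolding locally_integrable_on_def set_integrable_def
proof (intro allI impI, elim conjE)
  fix C assume C: "compact C" "C \<subseteq> U"
  obtain M where M: "\<forall>z\<in>C - E. norm (g' z v) * norm z \<le> M" using bd[OF C] by blast
  obtain R where R: "C \<subseteq> cball 0 R"
    using compact_imp_bounded[OF C(1)] bounded_subset_ballD[of C 0] ball_subset_cball by blast
  have EE: "insert 0 E \<in> null_sets lebesgue" using E by (simp add: negligible_iff_null_sets[symmetric])
  show "integrable lebesgue (\<lambda>z. indicator C z *\<^sub>R g' z v)"
  proof (rule Bochner_Integration.integrable_bound)
    show "integrable lebesgue (\<lambda>z::complex. M *\<^sub>R (indicator (cball 0 R) z / norm z :: real))"
      by (intro integrable_scaleR_right integrable_inverse_norm_cball)
    have "(\<lambda>z. indicator C z *\<^sub>R (indicator U z *\<^sub>R g' z v)) \<in> borel_measurable lebesgue"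
      using C(1) by (intro borel_measurable_scaleR directional_derivative_measurable[OF U cont E der]
          measurable_completion borel_measurable_indicator) (auto intro: borel_compact)
    also have "(\<lambda>z. indicator C z *\<^sub>R (indicator U z *\<^sub>R g' z v)) = (\<lambda>z. indicator C z *\<^sub>R g' z v)"
      using C(2) by (auto simp: indicator_def fun_eq_iff)
    finally show "(\<lambda>z. indicator C z *\<^sub>R g' z v) \<in> borel_measurable lebesgue" .
    show "AE z in lebesgue. norm (indicator C z *\<^sub>R g' z v)
        \<le> norm (M *\<^sub>R (indicator (cball 0 R) z / norm z :: real))"
      using AE_not_in[OF EE]
    proof eventually_elim
      fix z assume z: "z \<notin> insert 0 E"
      show "norm (indicator C z *\<^sub>R g' z v) \<le> norm (M *\<^sub>R (indicator (cball 0 R) z / norm z :: real))"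
      proof (cases "z \<in> C")
        case True
        then have "norm (g' z v) * norm z \<le> \<bar>M\<bar>" using M z by force
        then show ?thesis using True R z by (auto simp: field_simps)
      qed simp
    qed
  qed
qed

text \<open>A factor that vanishes at the origin to first order and tends to \<open>1\<close> elsewhere as \<open>a\<close> grows.
  Multiplication by it turns a function whose difference quotients blow up like the reciprocal of the
  norm into a Lipschitz function.\<close>

definition punctured_cutoff :: "real \<Rightarrow> 'a::real_inner \<Rightarrow> real" where
  "punctured_cutoff a z = a * norm z / (1 + a * norm z)"

definition punctured_cutoff_deriv :: "real \<Rightarrow> 'a::real_inner \<Rightarrow> 'a \<Rightarrow> real" where
  "punctured_cutoff_deriv a z v = a * (v \<bullet> sgn z) / (1 + a * norm z)\<^sup>2"

lemma punctured_cutoff_bounds: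
  assumes "0 < a"
  shows "0 \<le> punctured_cutoff a z" "punctured_cutoff a z \<le> 1" "punctured_cutoff a z \<le> a * norm z"
proof -
  have "0 < 1 + a * norm z" using assms by (simp add: add_pos_nonneg)
  then show "0 \<le> punctured_cutoff a z" "punctured_cutoff a z \<le> 1" "punctured_cutoff a z \<le> a * norm z"
    using assms by (auto simp: punctured_cutoff_def divide_simps algebra_simps)
qed

lemma punctured_cutoff_lipschitz:
  assumes a: "0 < a"
  shows "\<bar>punctured_cutoff a z - punctured_cutoff a w\<bar> \<le> a * norm (z - w)"
proof -
  have pos: "1 \<le> 1 + a * norm z" "1 \<le> 1 + a * norm w" using a by auto
  have "punctured_cutoff a z - punctured_cutoff a w = a * (norm z - norm w) / ((1 + a * norm z) * (1 + a * norm w))"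
    using pos by (simp add: punctured_cutoff_def divide_simps) (simp add: algebra_simps)
  then have "\<bar>punctured_cutoff a z - punctured_cutoff a w\<bar>
      = a * \<bar>norm z - norm w\<bar> / ((1 + a * norm z) * (1 + a * norm w))"
    using a pos by (simp add: abs_mult)
  also have "\<dots> \<le> a * \<bar>norm z - norm w\<bar> / 1"
    using a pos mult_mono[OF pos] by (intro divide_left_mono) auto
  also have "\<dots> \<le> a * norm (z - w)" using a by (simp add: norm_triangle_ineq3)
  finally show ?thesis .
qed

lemma punctured_cutoff_has_derivative:
  assumes a: "0 < a" and z: "z \<noteq> 0"
  shows "(punctured_cutoff a has_derivative punctured_cutoff_deriv a z) (at z)"
proof -
  have pos: "1 + a * norm z \<noteq> 0" using a by (smt (verit) mult_nonneg_nonneg norm_ge_zero)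
  have "((\<lambda>z. a * norm z / (1 + a * norm z)) has_derivative
      (\<lambda>v. (a * (v \<bullet> sgn z) * (1 + a * norm z) - a * norm z * (a * (v \<bullet> sgn z)))
           / ((1 + a * norm z) * (1 + a * norm z)))) (at z)"
    using pos z by (auto intro!: derivative_eq_intros has_derivative_norm simp: field_simps)
  also have "(\<lambda>z. a * norm z / (1 + a * norm z)) = punctured_cutoff a"
    by (simp add: punctured_cutoff_def fun_eq_iff)
  also have "(\<lambda>v. (a * (v \<bullet> sgn z) * (1 + a * norm z) - a * norm z * (a * (v \<bullet> sgn z)))
           / ((1 + a * norm z) * (1 + a * norm z))) = punctured_cutoff_deriv a z"
    by (simp add: punctured_cutoff_deriv_def fun_eq_iff power2_eq_square algebra_simps)
  finally show ?thesis .
qed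

text \<open>The first bound is uniform in \<open>a\<close> and locally integrable, so it serves as a dominating function; the
  second one shows that the derivative of the cutoff disappears in the limit.\<close>

lemma punctured_cutoff_deriv_bounds:
  assumes a: "0 < a" and z: "z \<noteq> 0"
  shows "\<bar>punctured_cutoff_deriv a z v\<bar> \<le> norm v / norm z"
    and "\<bar>punctured_cutoff_deriv a z v\<bar> \<le> norm v / (a * (norm z)\<^sup>2)"
proof -
  have pos: "0 < 1 + a * norm z" using a by (simp add: add_pos_nonneg)
  have "\<bar>v \<bullet> sgn z\<bar> \<le> norm v"
    using Cauchy_Schwarz_ineq2[of v "sgn z"] z by (simp add: norm_sgn)
  then have "\<bar>punctured_cutoff_deriv a z v\<bar> \<le> a * norm v / (1 + a * norm z)\<^sup>2"
    unfolding punctured_cutoff_deriv_def using a by (simp add: abs_mult divide_right_mono)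
  moreover have "a * norm v / (1 + a * norm z)\<^sup>2 \<le> a * norm v / (a * norm z)"
    using a z by (intro divide_left_mono) (auto simp: power2_eq_square algebra_simps add_pos_nonneg)
  moreover have "a * norm v / (1 + a * norm z)\<^sup>2 \<le> a * norm v / (a * norm z)\<^sup>2"
    using a z pos by (intro divide_left_mono power_mono) auto
  ultimately show "\<bar>punctured_cutoff_deriv a z v\<bar> \<le> norm v / norm z"
    and "\<bar>punctured_cutoff_deriv a z v\<bar> \<le> norm v / (a * (norm z)\<^sup>2)"
    using a by (auto simp: power2_eq_square mult_ac)
qed

lemma punctured_cutoff_tendsto:
  assumes z: "z \<noteq> 0"
  shows "(\<lambda>n. punctured_cutoff (real (Suc n)) z) \<longlonglongrightarrow> 1"
    and "(\<lambda>n. punctured_cutoff_deriv (real (Suc n)) z v) \<longlonglongrightarrow> 0"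
proof -
  have inv: "(\<lambda>n. inverse (real (Suc n)) * c) \<longlonglongrightarrow> 0" for c
    using tendsto_mult_left_zero[OF LIMSEQ_inverse_real_of_nat] .
  show "(\<lambda>n. punctured_cutoff (real (Suc n)) z) \<longlonglongrightarrow> 1"
  proof (rule Lim_null_comparison[where g = "\<lambda>n. inverse (real (Suc n)) * (1 / norm z)", THEN Lim_null[THEN iffD2]])
    show "\<forall>\<^sub>F n in sequentially. norm (punctured_cutoff (real (Suc n)) z - 1) \<le> inverse (real (Suc n)) * (1 / norm z)"
    proof (intro always_eventually allI)
      fix n
      define a where "a = real (Suc n)"
      have a: "0 < a" by (simp add: a_def)
      have pos: "0 < 1 + a * norm z" "0 < a * norm z" using a z by (auto simp: add_pos_nonneg)
      have "punctured_cutoff a z - 1 = - (1 / (1 + a * norm z))"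
        using pos by (simp add: punctured_cutoff_def field_simps)
      then have "norm (punctured_cutoff a z - 1) = 1 / (1 + a * norm z)" using pos by simp
      also have "\<dots> \<le> 1 / (a * norm z)" using pos by (intro divide_left_mono) auto
      finally show "norm (punctured_cutoff (real (Suc n)) z - 1) \<le> inverse (real (Suc n)) * (1 / norm z)"
        by (simp add: a_def field_simps)
    qed
  qed (rule inv)
  show "(\<lambda>n. punctured_cutoff_deriv (real (Suc n)) z v) \<longlonglongrightarrow> 0"
  proof (rule Lim_null_comparison[where g = "\<lambda>n. inverse (real (Suc n)) * (norm v / (norm z)\<^sup>2)"])
    show "\<forall>\<^sub>F n in sequentially. norm (punctured_cutoff_deriv (real (Suc n)) z v) \<le> inverse (real (Suc n)) * (norm v / (norm z)\<^sup>2)"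
    proof (intro always_eventually allI)
      fix n show "norm (punctured_cutoff_deriv (real (Suc n)) z v) \<le> inverse (real (Suc n)) * (norm v / (norm z)\<^sup>2)"
        using punctured_cutoff_deriv_bounds(2)[of "real (Suc n)" z v] z by (simp add: divide_inverse mult_ac)
    qed
  qed (rule inv)
qed

text \<open>The hypotheses allow \<open>g\<close> to have a singularity at the origin of the kind of a real power of the norm
  with small positive exponent, as the extension has at infinity in the coordinate \<open>1 / z\<close>:
  the local Lipschitz constant is only bounded by a multiple of the reciprocal of the norm. With the cutoff
  \<open>\<chi>\<^sub>n\<close> the product \<open>g * \<chi>\<^sub>n * \<phi>\<close> is globally Lipschitz, so its directional derivative has integral
  zero. As \<open>n\<close> grows, the term that contains the derivative of \<open>\<chi>\<^sub>n\<close> drops out by dominated convergence.\<close>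

lemma singular_integration_by_parts:
  fixes g :: "complex \<Rightarrow> complex"
  assumes U: "open U" and cont: "continuous_on U g" and E: "negligible E"
    and lip: "\<And>C. compact C \<Longrightarrow> C \<subseteq> U \<Longrightarrow>
      \<exists>M. \<forall>z\<in>C. \<forall>w\<in>C. norm (g z - g w) * norm z \<le> M * norm (z - w)"
    and der: "\<And>z. z \<in> U - E \<Longrightarrow> (g has_derivative g' z) (at z)"
    and bd: "\<And>C. compact C \<Longrightarrow> C \<subseteq> U \<Longrightarrow> \<exists>M. \<forall>z\<in>C - E. norm (g' z v) * norm z \<le> M"
    and test: "test_function_on U \<phi>"
  shows "set_integrable lebesgue U (\<lambda>z. g z * frechet_derivative \<phi> (at z) v)"
    and "set_integrable lebesgue U (\<lambda>z. g' z v * \<phi> z)"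
    and "(LINT z:U|lebesgue. g z * frechet_derivative \<phi> (at z) v) = - (LINT z:U|lebesgue. g' z v * \<phi> z)"
proof -
  obtain C L where C: "compact C" "C \<subseteq> U" and L: "0 \<le> L" and lip_phi: "L-lipschitz_on UNIV \<phi>"
    and der_phi: "\<And>z. (\<phi> has_derivative frechet_derivative \<phi> (at z)) (at z)"
    and bd_phi: "\<And>z v. norm (frechet_derivative \<phi> (at z) v) \<le> L * norm v"
    and cont_D: "\<And>v. continuous_on UNIV (\<lambda>z. frechet_derivative \<phi> (at z) v)"
    and phi0: "\<And>z. z \<notin> C \<Longrightarrow> \<phi> z = 0"
    and D0: "\<And>z v. z \<notin> C \<Longrightarrow> frechet_derivative \<phi> (at z) v = 0"
    using test_function_regularity[OF test] by blast
  define D where "D = (\<lambda>z. frechet_derivative \<phi> (at z))"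
  have cont_phi: "continuous_on UNIV \<phi>" using lip_phi by (rule lipschitz_on_continuous_on)
  obtain Mp where Mp: "0 \<le> Mp" "\<And>z. z \<in> C \<Longrightarrow> norm (\<phi> z) \<le> Mp"
    using compact_norm_bound[OF continuous_on_subset[OF cont_phi subset_UNIV] C(1)] by blast
  obtain Mg where Mg: "0 \<le> Mg" "\<And>z. z \<in> C \<Longrightarrow> norm (g z) \<le> Mg"
    using compact_norm_bound[OF continuous_on_subset[OF cont C(2)] C(1)] by blast
  obtain Ml0 where "\<forall>z\<in>C. \<forall>w\<in>C. norm (g z - g w) * norm z \<le> Ml0 * norm (z - w)" using lip[OF C] by blast
  then have Ml: "norm (g z - g w) * norm z \<le> \<bar>Ml0\<bar> * norm (z - w)" if "z \<in> C" "w \<in> C" for z w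
    using that by (meson abs_ge_self mult_right_mono norm_ge_zero order_trans)
  have phi_le: "norm (\<phi> z) \<le> Mp" for z using Mp phi0[of z] by (cases "z \<in> C") auto
  have lip_phi': "norm (\<phi> z - \<phi> w) \<le> L * norm (z - w)" for z w
    using lipschitz_onD[OF lip_phi, of z w] by (simp add: dist_norm)
  obtain R where R: "C \<subseteq> cball 0 R"
    using compact_imp_bounded[OF C(1)] bounded_subset_ballD[of C 0] ball_subset_cball by blast

  have C_leb: "C \<in> sets borel" using C(1) by (rule borel_compact)
  have int_gD: "integrable lebesgue (\<lambda>z. g z * D z v)"
  proof -
    have "integrable lborel (\<lambda>z. indicator C z *\<^sub>R (g z * D z v))"
      unfolding D_def by (intro borel_integrable_compact C continuous_intros
          continuous_on_subset[OF cont C(2)] continuous_on_subset[OF cont_D subset_UNIV])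
    also have "(\<lambda>z. indicator C z *\<^sub>R (g z * D z v)) = (\<lambda>z. g z * D z v)"
      using D0 by (auto simp: indicator_def fun_eq_iff D_def)
    finally show ?thesis by (simp add: integrable_completion borel_measurable_integrable)
  qed
  have int_g'phi: "integrable lebesgue (\<lambda>z. g' z v * \<phi> z)"
  proof (rule Bochner_Integration.integrable_bound)
    have "integrable lebesgue (\<lambda>z. indicator C z *\<^sub>R g' z v)"
      using singular_derivative_locally_integrable[OF U cont E der bd] C
      unfolding locally_integrable_on_def set_integrable_def by blast
    note i = this
    then show "integrable lebesgue (\<lambda>z. Mp *\<^sub>R (indicator C z *\<^sub>R g' z v))" by (rule integrable_scaleR_right)
    have "(\<lambda>z. (indicator C z *\<^sub>R g' z v) * \<phi> z) \<in> borel_measurable lebesgue"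
      by (intro borel_measurable_times borel_measurable_integrable[OF i] measurable_completion)
         (simp add: borel_measurable_continuous_onI cont_phi)
    also have "(\<lambda>z. (indicator C z *\<^sub>R g' z v) * \<phi> z) = (\<lambda>z. g' z v * \<phi> z)"
      using phi0 by (auto simp: indicator_def fun_eq_iff)
    finally show "(\<lambda>z. g' z v * \<phi> z) \<in> borel_measurable lebesgue" .
    show "AE z in lebesgue. norm (g' z v * \<phi> z) \<le> norm (Mp *\<^sub>R (indicator C z *\<^sub>R g' z v))"
    proof (intro always_eventually allI)
      fix z show "norm (g' z v * \<phi> z) \<le> norm (Mp *\<^sub>R (indicator C z *\<^sub>R g' z v))"
        using phi_le[of z] phi0[of z] Mp(1)
        by (cases "z \<in> C") (auto simp: norm_mult mult.commute[of _ "norm (\<phi> z)"] intro: mult_right_mono)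
    qed
  qed
  have set_eq: "(\<lambda>z. indicator U z *\<^sub>R (g z * D z v)) = (\<lambda>z. g z * D z v)"
    "(\<lambda>z. indicator U z *\<^sub>R (g' z v * \<phi> z)) = (\<lambda>z. g' z v * \<phi> z)"
    using C(2) phi0 D0 by (auto simp: indicator_def fun_eq_iff D_def)
  show "set_integrable lebesgue U (\<lambda>z. g z * frechet_derivative \<phi> (at z) v)"
    and "set_integrable lebesgue U (\<lambda>z. g' z v * \<phi> z)"
    using int_gD int_g'phi set_eq unfolding set_integrable_def by (simp_all add: D_def)

  define chi where "chi = (\<lambda>n (z::complex). complex_of_real (punctured_cutoff (real (Suc n)) z))"
  define psi where "psi = (\<lambda>n z. g z * chi n z * \<phi> z)"
  define psi' where "psi' = (\<lambda>n z v. g' z v * chi n z * \<phi> z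
    + g z * complex_of_real (punctured_cutoff_deriv (real (Suc n)) z v) * \<phi> z + g z * chi n z * D z v)"
  have chi_le: "norm (chi n z) \<le> 1" "norm (chi n z) \<le> real (Suc n) * norm z" for n z
    using punctured_cutoff_bounds[of "real (Suc n)" z] by (auto simp: chi_def simp del: of_nat_Suc)
  have chi_lip: "norm (chi n z - chi n w) \<le> real (Suc n) * norm (z - w)" for n z w
    using punctured_cutoff_lipschitz[of "real (Suc n)" z w]
    by (simp add: chi_def norm_of_real del: of_nat_Suc flip: of_real_diff)
  \<comment> \<open>The bound \<open>norm (chi n z) \<le> Suc n * norm z\<close> absorbs the factor \<open>norm z\<close> in the hypothesis on \<open>g\<close>.\<close>
  have psi_lip: "(real (Suc n) * (\<bar>Ml0\<bar> * Mp + Mg * Mp) + Mg * L)-lipschitz_on UNIV (psi n)" for n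
  proof (rule lipschitz_onI)
    define N where "N = real (Suc n)"
    have N: "0 \<le> N" by (simp add: N_def)
    have K: "norm (psi n z - psi n w) \<le> (N * (\<bar>Ml0\<bar> * Mp + Mg * Mp) + Mg * L) * norm (z - w)"
      if z: "z \<in> C" for z w
    proof (cases "w \<in> C")
      case True
      have "psi n z - psi n w = (g z - g w) * chi n z * \<phi> z + g w * (chi n z - chi n w) * \<phi> z
          + g w * chi n w * (\<phi> z - \<phi> w)"
        by (simp add: psi_def algebra_simps)
      also have "norm \<dots> \<le> norm ((g z - g w) * chi n z * \<phi> z) + norm (g w * (chi n z - chi n w) * \<phi> z)
          + norm (g w * chi n w * (\<phi> z - \<phi> w))"
        by (intro norm_triangle_le add_mono) auto
      also have "norm ((g z - g w) * chi n z * \<phi> z) \<le> (N * (\<bar>Ml0\<bar> * norm (z - w))) * Mp"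
      proof -
        have "norm (g z - g w) * norm (chi n z) \<le> norm (g z - g w) * (N * norm z)"
          using chi_le(2)[of n z] by (intro mult_left_mono) (auto simp: N_def)
        also have "\<dots> = N * (norm (g z - g w) * norm z)" by simp
        also have "\<dots> \<le> N * (\<bar>Ml0\<bar> * norm (z - w))" using Ml[OF z True] N by (rule mult_left_mono)
        finally show ?thesis using mult_mono[OF _ phi_le[of z]] N by (simp add: norm_mult)
      qed
      also have "norm (g w * (chi n z - chi n w) * \<phi> z) \<le> Mg * (N * norm (z - w)) * Mp"
        unfolding norm_mult using Mg True chi_lip[of n z w] phi_le N
        by (intro mult_mono) (auto simp: N_def)
      also have "norm (g w * chi n w * (\<phi> z - \<phi> w)) \<le> Mg * 1 * (L * norm (z - w))"
        unfolding norm_mult using Mg True chi_le(1)[of n w] lip_phi'[of z w] L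
        by (intro mult_mono) auto
      finally show ?thesis by (simp add: algebra_simps)
    next
      case False
      have "norm (psi n z - psi n w) = norm (g z) * norm (chi n z) * norm (\<phi> z - \<phi> w)"
        using phi0[OF False] by (simp add: psi_def norm_mult)
      also have "\<dots> \<le> Mg * 1 * (L * norm (z - w))"
        using Mg z chi_le(1)[of n z] lip_phi'[of z w] L by (intro mult_mono) auto
      also have "\<dots> \<le> (N * (\<bar>Ml0\<bar> * Mp + Mg * Mp) + Mg * L) * norm (z - w)"
        using N Mp(1) Mg(1) by (simp add: algebra_simps)
      finally show ?thesis .
    qed
    fix z w
    show "dist (psi n z) (psi n w) \<le> (real (Suc n) * (\<bar>Ml0\<bar> * Mp + Mg * Mp) + Mg * L) * dist z w"
    proof (cases "z \<in> C \<or> w \<in> C")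
      case True
      then show ?thesis using K[of z w] K[of w z] by (auto simp: dist_norm N_def norm_minus_commute)
    next
      case False
      then have "psi n z = 0" "psi n w = 0" using phi0 by (auto simp: psi_def)
      then show ?thesis using Mp(1) Mg(1) L by simp
    qed
  qed (use Mp(1) Mg(1) L in simp)

  have EE: "insert 0 E \<in> null_sets lebesgue" using E by (simp add: negligible_iff_null_sets[symmetric])
  have psi_der: "(psi n has_derivative psi' n z) (at z)" if z: "z \<notin> insert 0 E" for n z
  proof (cases "z \<in> C")
    case True
    have *: "(chi n has_derivative (\<lambda>v. complex_of_real (punctured_cutoff_deriv (real (Suc n)) z v))) (at z)"
      unfolding chi_def using z by (intro has_derivative_of_real punctured_cutoff_has_derivative) auto
    show ?thesis unfolding psi_def psi'_def D_def
      by (rule has_derivative_eq_rhs, rule has_derivative_mult[OF has_derivative_mult[OF der *] der_phi])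
         (use True C z in \<open>auto simp: algebra_simps\<close>)
  next
    case False
    have "(psi n has_derivative (\<lambda>_. 0)) (at z)"
      by (rule has_derivative_transform_within_open[where f = "\<lambda>_. 0" and s = "- C"])
         (use False phi0 C(1) in \<open>auto intro: compact_imp_closed simp: psi_def\<close>)
    moreover have "psi' n z = (\<lambda>_. 0)" using False phi0 D0 by (auto simp: psi'_def D_def)
    ultimately show ?thesis by simp
  qed
  have psi'_eq: "psi' n z v = chi n z * (g' z v * \<phi> z) + of_real (punctured_cutoff_deriv (real (Suc n)) z v) * (g z * \<phi> z)
      + chi n z * (g z * D z v)" for n z by (simp add: psi'_def)
  have chi_meas: "chi n \<in> borel_measurable lebesgue" for n
  proof -
    have "chi n \<in> borel_measurable borel" unfolding chi_def punctured_cutoff_def by measurable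
    then show ?thesis by (simp add: measurable_completion)
  qed
  have cutd_meas: "(\<lambda>z. complex_of_real (punctured_cutoff_deriv a z v)) \<in> borel_measurable lebesgue" for a
  proof -
    have "(\<lambda>z::complex. complex_of_real (punctured_cutoff_deriv a z v)) \<in> borel_measurable borel"
      unfolding punctured_cutoff_deriv_def sgn_div_norm by measurable
    then show ?thesis by (simp add: measurable_completion)
  qed
  have gphi_meas: "(\<lambda>z. g z * \<phi> z) \<in> borel_measurable lebesgue"
  proof -
    have "integrable lborel (\<lambda>z. indicator C z *\<^sub>R (g z * \<phi> z))"
      by (intro borel_integrable_compact C continuous_intros
          continuous_on_subset[OF cont C(2)] continuous_on_subset[OF cont_phi subset_UNIV])
    also have "(\<lambda>z. indicator C z *\<^sub>R (g z * \<phi> z)) = (\<lambda>z. g z * \<phi> z)"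
      using phi0 by (auto simp: indicator_def fun_eq_iff)
    finally show ?thesis by (simp add: measurable_completion borel_measurable_integrable)
  qed
  have psi'_meas: "(\<lambda>z. psi' n z v) \<in> borel_measurable lebesgue" for n
    unfolding psi'_eq by (intro borel_measurable_add borel_measurable_times chi_meas cutd_meas gphi_meas
        borel_measurable_integrable[OF int_g'phi] borel_measurable_integrable[OF int_gD])
  have psi'_0: "(LINT z|lebesgue. psi' n z v) = 0" for n
  proof (rule integral_directional_derivative_eq_0[OF psi_lip])
    show "psi n z = 0" if "R < norm z" for z using R phi0[of z] that by (force simp: psi_def)
    show "AE z in lebesgue. (psi n has_derivative psi' n z) (at z)"
      using AE_not_in[OF EE] by eventually_elim (rule psi_der)
  qed (rule psi'_meas)
  have "(\<lambda>n. LINT z|lebesgue. psi' n z v) \<longlonglongrightarrow> (LINT z|lebesgue. g' z v * \<phi> z + g z * D z v)"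
  proof (rule integral_dominated_convergence[where w = "\<lambda>z. norm (g' z v * \<phi> z)
      + (Mg * Mp * norm v) *\<^sub>R (indicator (cball 0 R) z / norm z) + norm (g z * D z v)"])
    show "(\<lambda>z. g' z v * \<phi> z + g z * D z v) \<in> borel_measurable lebesgue"
      using int_g'phi int_gD by (intro borel_measurable_integrable Bochner_Integration.integrable_add)
    show "integrable lebesgue (\<lambda>z. norm (g' z v * \<phi> z)
      + (Mg * Mp * norm v) *\<^sub>R (indicator (cball 0 R) z / norm z) + norm (g z * D z v))"
      by (intro Bochner_Integration.integrable_add integrable_norm int_g'phi int_gD integrable_scaleR_right
          integrable_inverse_norm_cball)
    show "AE z in lebesgue. (\<lambda>n. psi' n z v) \<longlonglongrightarrow> g' z v * \<phi> z + g z * D z v"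
      using AE_not_in[OF EE]
    proof eventually_elim
      fix z assume z: "z \<notin> insert 0 E"
      have "(\<lambda>n. psi' n z v) \<longlonglongrightarrow> of_real 1 * (g' z v * \<phi> z) + of_real 0 * (g z * \<phi> z) + of_real 1 * (g z * D z v)"
        unfolding psi'_eq chi_def using z by (intro tendsto_intros punctured_cutoff_tendsto) auto
      then show "(\<lambda>n. psi' n z v) \<longlonglongrightarrow> g' z v * \<phi> z + g z * D z v" by simp
    qed
    fix n
    show "AE z in lebesgue. norm (psi' n z v) \<le> norm (g' z v * \<phi> z)
      + (Mg * Mp * norm v) *\<^sub>R (indicator (cball 0 R) z / norm z) + norm (g z * D z v)"
      using AE_not_in[OF EE]
    proof eventually_elim
      fix z assume z: "z \<notin> insert 0 E"
      have "norm (psi' n z v) \<le> norm (chi n z * (g' z v * \<phi> z))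
          + norm (complex_of_real (punctured_cutoff_deriv (real (Suc n)) z v) * (g z * \<phi> z))
          + norm (chi n z * (g z * D z v))"
        unfolding psi'_eq by (intro norm_triangle_le add_mono) auto
      also have "norm (chi n z * (g' z v * \<phi> z)) \<le> norm (g' z v * \<phi> z)"
        using mult_right_mono[OF chi_le(1)[of n z], of "norm (g' z v * \<phi> z)"] by (simp add: norm_mult)
      also have "norm (chi n z * (g z * D z v)) \<le> norm (g z * D z v)"
        using mult_right_mono[OF chi_le(1)[of n z], of "norm (g z * D z v)"] by (simp add: norm_mult)
      also have "norm (complex_of_real (punctured_cutoff_deriv (real (Suc n)) z v) * (g z * \<phi> z))
          \<le> (Mg * Mp * norm v) *\<^sub>R (indicator (cball 0 R) z / norm z)"
      proof (cases "z \<in> C")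
        case True
        have "norm (complex_of_real (punctured_cutoff_deriv (real (Suc n)) z v) * (g z * \<phi> z))
            \<le> (norm v / norm z) * (Mg * Mp)"
          unfolding norm_mult norm_of_real using punctured_cutoff_deriv_bounds(1)[of "real (Suc n)" z v] z Mg True phi_le
          by (intro mult_mono) auto
        then show ?thesis using True R by (auto simp: field_simps)
      next
        case False
        then show ?thesis using phi0 Mg(1) Mp(1) by (simp add: indicator_def)
      qed
      finally show "norm (psi' n z v) \<le> norm (g' z v * \<phi> z)
        + (Mg * Mp * norm v) *\<^sub>R (indicator (cball 0 R) z / norm z) + norm (g z * D z v)" by simp
    qed
  qed (rule psi'_meas)
  then have "(LINT z|lebesgue. g' z v * \<phi> z + g z * D z v) = 0"
    using psi'_0 by (simp add: LIMSEQ_const_iff)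
  then have "(LINT z|lebesgue. g' z v * \<phi> z) + (LINT z|lebesgue. g z * D z v) = 0"
    using int_g'phi int_gD by simp
  then show "(LINT z:U|lebesgue. g z * frechet_derivative \<phi> (at z) v) = - (LINT z:U|lebesgue. g' z v * \<phi> z)"
    unfolding set_lebesgue_integral_def using set_eq by (simp add: D_def eq_neg_iff_add_eq_0 add.commute)
qed

section \<open>The Beltrami inequality from pointwise derivatives\<close>

text \<open>A real differential \<open>v \<mapsto> A v + B cnj v\<close> has Wirtinger coefficients \<open>A\<close> and \<open>B\<close>. Integration by parts in
  the directions \<open>1\<close> and \<open>\<i>\<close> shows that these pointwise coefficients are also the distributional
  derivatives.\<close>

lemma beltrami_inequality_onI:
  fixes g A B :: "complex \<Rightarrow> complex"
  assumes U: "open U" and cont: "continuous_on U g" and E: "negligible E"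
    and lip: "\<And>C. compact C \<Longrightarrow> C \<subseteq> U \<Longrightarrow>
      \<exists>M. \<forall>z\<in>C. \<forall>w\<in>C. norm (g z - g w) * norm z \<le> M * norm (z - w)"
    and der: "\<And>z. z \<in> U - E \<Longrightarrow> (g has_derivative (\<lambda>v. A z * v + B z * cnj v)) (at z)"
    and dil: "\<And>z. z \<in> U - E \<Longrightarrow> norm (B z) \<le> k * norm (A z)"
    and bd: "\<And>C. compact C \<Longrightarrow> C \<subseteq> U \<Longrightarrow> \<exists>M. \<forall>z\<in>C - E. (norm (A z) + norm (B z)) * norm z \<le> M"
  shows "beltrami_inequality_on k U g"
proof -
  define g' where "g' = (\<lambda>z v. A z * v + B z * cnj v)"
  have der': "\<And>z. z \<in> U - E \<Longrightarrow> (g has_derivative g' z) (at z)"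
    unfolding g'_def by (rule der)
  have bd': "\<exists>M. \<forall>z\<in>C - E. norm (g' z v) * norm z \<le> M" if C: "compact C" "C \<subseteq> U" for C v
  proof -
    obtain M where M: "\<forall>z\<in>C - E. (norm (A z) + norm (B z)) * norm z \<le> M" using bd[OF C] by blast
    have "norm (g' z v) * norm z \<le> M * norm v" if "z \<in> C - E" for z
    proof -
      have "norm (g' z v) \<le> norm (A z) * norm v + norm (B z) * norm v"
        unfolding g'_def by (rule order_trans[OF norm_triangle_ineq]) (simp add: norm_mult)
      then have "norm (g' z v) * norm z \<le> ((norm (A z) + norm (B z)) * norm v) * norm z"
        by (intro mult_right_mono) (auto simp: distrib_right)
      also have "\<dots> = ((norm (A z) + norm (B z)) * norm z) * norm v" by simp
      also have "\<dots> \<le> M * norm v" using M that by (intro mult_right_mono) auto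
      finally show ?thesis .
    qed
    then show ?thesis by blast
  qed
  have g'1: "g' z 1 = A z + B z" and g'i: "g' z \<i> = \<i> * (A z - B z)" for z
    by (simp_all add: g'_def algebra_simps)
  have AB: "A z = (g' z 1 - \<i> * g' z \<i>) / 2" "B z = (g' z 1 + \<i> * g' z \<i>) / 2" for z
  proof -
    have "\<i> * g' z \<i> = B z - A z" unfolding g'i by (simp flip: mult.assoc)
    then show "A z = (g' z 1 - \<i> * g' z \<i>) / 2" "B z = (g' z 1 + \<i> * g' z \<i>) / 2"
      by (simp_all add: g'1)
  qed
  have li: "(\<lambda>z. g' z v) absolutely_integrable_on C" if "compact C" "C \<subseteq> U" for v C
    using singular_derivative_locally_integrable[OF U cont E der' bd', of v] that
    unfolding locally_integrable_on_def by blast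
  have liA: "locally_integrable_on A U" "locally_integrable_on B U"
    unfolding locally_integrable_on_def AB
    by (intro allI impI set_integrable_divide set_integral_diff(1) set_integral_add(1) set_integrable_mult_right li; simp)+
  have dz: "has_distributional_dz g A U" "has_distributional_dzbar g B U"
    unfolding has_distributional_dz_def has_distributional_dzbar_def
  proof (safe)
    fix \<phi> assume test: "test_function_on U \<phi>"
    let ?D = "\<lambda>v z. frechet_derivative \<phi> (at z) v"
    have i: "set_integrable lebesgue U (\<lambda>z. g z * ?D v z)" "set_integrable lebesgue U (\<lambda>z. g' z v * \<phi> z)"
      and e: "(LINT z:U|lebesgue. g z * ?D v z) = - (LINT z:U|lebesgue. g' z v * \<phi> z)" for v
      by (rule singular_integration_by_parts[OF U cont E _ _ _ test]; rule lip der' bd'; assumption)+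
    have "(LINT z:U|lebesgue. g z * wirtinger_dz \<phi> z)
        = (LINT z:U|lebesgue. (1/2) * (g z * ?D 1 z) - (\<i>/2) * (g z * ?D \<i> z))"
      by (simp add: wirtinger_dz_def partial_x_def partial_y_def algebra_simps diff_divide_distrib)
    also have "\<dots> = (1/2) * (LINT z:U|lebesgue. g z * ?D 1 z) - (\<i>/2) * (LINT z:U|lebesgue. g z * ?D \<i> z)"
      by (subst set_integral_diff(2)) (auto intro!: set_integrable_mult_right i)
    also have "\<dots> = - ((1/2) * (LINT z:U|lebesgue. g' z 1 * \<phi> z) - (\<i>/2) * (LINT z:U|lebesgue. g' z \<i> * \<phi> z))"
      by (simp add: e)
    also have "\<dots> = - (LINT z:U|lebesgue. (1/2) * (g' z 1 * \<phi> z) - (\<i>/2) * (g' z \<i> * \<phi> z))"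
      by (subst set_integral_diff(2)) (auto intro!: set_integrable_mult_right i)
    also have "(\<lambda>z. (1/2) * (g' z 1 * \<phi> z) - (\<i>/2) * (g' z \<i> * \<phi> z)) = (\<lambda>z. A z * \<phi> z)"
      by (auto simp: AB fun_eq_iff algebra_simps diff_divide_distrib)
    finally show "(LINT z:U|lebesgue. g z * wirtinger_dz \<phi> z) = - (LINT z:U|lebesgue. A z * \<phi> z)" .
    have "(LINT z:U|lebesgue. g z * wirtinger_dzbar \<phi> z)
        = (LINT z:U|lebesgue. (1/2) * (g z * ?D 1 z) + (\<i>/2) * (g z * ?D \<i> z))"
      by (simp add: wirtinger_dzbar_def partial_x_def partial_y_def algebra_simps add_divide_distrib)
    also have "\<dots> = (1/2) * (LINT z:U|lebesgue. g z * ?D 1 z) + (\<i>/2) * (LINT z:U|lebesgue. g z * ?D \<i> z)"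
      by (subst set_integral_add(2)) (auto intro!: set_integrable_mult_right i)
    also have "\<dots> = - ((1/2) * (LINT z:U|lebesgue. g' z 1 * \<phi> z) + (\<i>/2) * (LINT z:U|lebesgue. g' z \<i> * \<phi> z))"
      by (simp add: e)
    also have "\<dots> = - (LINT z:U|lebesgue. (1/2) * (g' z 1 * \<phi> z) + (\<i>/2) * (g' z \<i> * \<phi> z))"
      by (subst set_integral_add(2)) (auto intro!: set_integrable_mult_right i)
    also have "(\<lambda>z. (1/2) * (g' z 1 * \<phi> z) + (\<i>/2) * (g' z \<i> * \<phi> z)) = (\<lambda>z. B z * \<phi> z)"
      by (auto simp: AB fun_eq_iff algebra_simps add_divide_distrib)
    finally show "(LINT z:U|lebesgue. g z * wirtinger_dzbar \<phi> z) = - (LINT z:U|lebesgue. B z * \<phi> z)" .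
  qed
  have EE: "E \<in> null_sets lebesgue" using E by (simp add: negligible_iff_null_sets)
  have "AE z in lebesgue. z \<in> U \<longrightarrow> norm (B z) \<le> k * norm (A z)"
    using AE_not_in[OF EE] by eventually_elim (use dil in auto)
  with liA dz show ?thesis unfolding beltrami_inequality_on_def by blast
qed

lemma norm_exp_diff_le:
  assumes "norm (exp a) \<le> M" "norm (exp b) \<le> M"
  shows "norm (exp a - exp b :: complex) \<le> M * norm (a - b)"
proof -
  have M: "0 < M" using assms(1) by (smt (verit) norm_exp_eq_Re exp_gt_zero norm_exp norm_exp_eq_Re)
  show ?thesis
  proof (rule field_differentiable_bound[where S = "{x. Re x \<le> ln M}" and f' = exp])
    show "convex {x. Re x \<le> ln M}" by (rule convex_halfspace_Re_le)
    show "norm (exp x) \<le> M" if "x \<in> {x. Re x \<le> ln M}" for x :: complex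
      using that M by (simp add: norm_exp_eq_Re) (metis exp_le_cancel_iff exp_ln)
    show "a \<in> {x. Re x \<le> ln M}" "b \<in> {x. Re x \<le> ln M}"
      using assms M by (auto simp: norm_exp_eq_Re ln_ge_iff)
  qed (auto intro!: derivative_eq_intros)
qed

lemma lipschitz_has_derivative_bound:
  fixes f :: "'a::real_normed_vector \<Rightarrow> 'b::real_normed_vector"
  assumes "L-lipschitz_on UNIV f" "(f has_derivative f') (at z)"
  shows "norm (f' v) \<le> L * norm v"
proof (rule tendsto_upperbound[OF tendsto_norm[OF has_derivative_imp_difference_quotients[OF assms(2)]]])
  show "\<forall>\<^sub>F n in sequentially. norm (real (Suc n) *\<^sub>R (f (z + v /\<^sub>R real (Suc n)) - f z)) \<le> L * norm v"
  proof (intro always_eventually allI)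
    fix n
    have "norm (f (z + v /\<^sub>R real (Suc n)) - f z) \<le> L * norm (v /\<^sub>R real (Suc n))"
      using lipschitz_onD[OF assms(1), of "z + v /\<^sub>R real (Suc n)" z] by (simp add: dist_norm)
    then have "norm (real (Suc n) *\<^sub>R (f (z + v /\<^sub>R real (Suc n)) - f z)) \<le> real (Suc n) * (L * norm (v /\<^sub>R real (Suc n)))"
      unfolding norm_scaleR by (intro mult_mono) auto
    also have "\<dots> = L * norm v" by simp
    finally show "norm (real (Suc n) *\<^sub>R (f (z + v /\<^sub>R real (Suc n)) - f z)) \<le> L * norm v" .
  qed
qed simp

text \<open>In logarithmic coordinates \<open>g\<close> is the map \<open>H\<close>. The exponential is conformal, so the ratio of the two
  Wirtinger coefficients has the same modulus for \<open>g\<close> as for \<open>H\<close>. The Lipschitz constant of \<open>H\<close> gives the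
  bounds at the origin: lengths near \<open>z\<close> are divided by \<open>norm z\<close> in the logarithmic coordinate and
  multiplied by \<open>norm (g z)\<close> on the way back.\<close>

lemma beltrami_inequality_exp_lift:
  fixes g H :: "complex \<Rightarrow> complex"
  assumes U: "open U" and cont: "continuous_on U g"
    and lift: "\<And>\<zeta>. g (exp \<zeta>) = exp (H \<zeta>)"
    and lip: "L-lipschitz_on UNIV H"
    and E: "negligible E"
    and derH: "\<And>\<zeta>. exp \<zeta> \<notin> E \<Longrightarrow>
      \<exists>a b. (H has_derivative (\<lambda>v. a * v + b * cnj v)) (at \<zeta>) \<and> norm b \<le> k * norm a"
  shows "beltrami_inequality_on k U g"
proof -
  have L: "0 \<le> L" using lip by (rule lipschitz_on_nonneg)
  obtain a b where ab: "\<And>\<zeta>. exp \<zeta> \<notin> E \<Longrightarrow> (H has_derivative (\<lambda>v. a \<zeta> * v + b \<zeta> * cnj v)) (at \<zeta>)"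
    "\<And>\<zeta>. exp \<zeta> \<notin> E \<Longrightarrow> norm (b \<zeta>) \<le> k * norm (a \<zeta>)"
    using derH by metis
  have ab_le: "norm (a \<zeta>) + norm (b \<zeta>) \<le> 2 * L" if "exp \<zeta> \<notin> E" for \<zeta>
  proof -
    have 1: "norm (a \<zeta> + b \<zeta>) \<le> L" and 2: "norm (a \<zeta> - b \<zeta>) \<le> L"
      using lipschitz_has_derivative_bound[OF lip ab(1)[OF that], of 1]
        lipschitz_has_derivative_bound[OF lip ab(1)[OF that], of \<i>]
      by (auto simp: norm_mult simp flip: right_diff_distrib' mult.commute[of \<i>] minus_mult_right)
    have "2 * norm (a \<zeta>) \<le> norm (a \<zeta> + b \<zeta>) + norm (a \<zeta> - b \<zeta>)"
      using norm_triangle_ineq[of "a \<zeta> + b \<zeta>" "a \<zeta> - b \<zeta>"] by (simp add: norm_mult flip: mult_2)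
    moreover have "2 * norm (b \<zeta>) \<le> norm (a \<zeta> + b \<zeta>) + norm (a \<zeta> - b \<zeta>)"
      using norm_triangle_ineq4[of "a \<zeta> + b \<zeta>" "a \<zeta> - b \<zeta>"] by (simp add: norm_mult flip: mult_2)
    ultimately show ?thesis using 1 2 by linarith
  qed
  define A where "A = (\<lambda>z. g z * a (Ln z) / z)"
  define B where "B = (\<lambda>z. g z * b (Ln z) / cnj z)"
  \<comment> \<open>A branch of the logarithm that is holomorphic near \<open>z\<close>, also when \<open>z\<close> is a negative real.\<close>
  have branch: "g w = exp (H (Ln z + Ln (w / z)))" if "z \<noteq> 0" "w \<noteq> 0" for z w
    using lift[of "Ln z + Ln (w / z)"] that by (simp add: exp_add)
  show ?thesis
  proof (rule beltrami_inequality_onI[where A = A and B = B and E = "insert 0 E"])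
    show "negligible (insert 0 E)" using E by simp
    fix z assume "z \<in> U - insert 0 E"
    then have z: "z \<noteq> 0" "exp (Ln z) \<notin> E" by auto
    have Ln0: "Ln z + Ln (z / z) = Ln z" using z by simp
    have "((\<lambda>w. Ln z + Ln (w / z)) has_field_derivative 1 / z) (at z)"
      using z by (auto intro!: derivative_eq_intros)
    then have d1: "((\<lambda>w. Ln z + Ln (w / z)) has_derivative (\<lambda>v. v / z)) (at z)"
      unfolding has_field_derivative_def by (rule has_derivative_eq_rhs) (auto simp: fun_eq_iff)
    have d2: "((\<lambda>w. H (Ln z + Ln (w / z))) has_derivative
        (\<lambda>v. a (Ln z) * (v / z) + b (Ln z) * cnj (v / z))) (at z)"
      by (rule has_derivative_compose[OF d1]) (use ab(1)[OF z(2)] Ln0 in simp)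
    have d3: "(exp has_derivative (\<lambda>v. exp (H (Ln z)) * v)) (at (H (Ln z + Ln (z / z))))"
      using DERIV_exp[of "H (Ln z)"] Ln0 by (simp add: has_field_derivative_def)
    have "((\<lambda>w. exp (H (Ln z + Ln (w / z)))) has_derivative
        (\<lambda>v. exp (H (Ln z)) * (a (Ln z) * (v / z) + b (Ln z) * cnj (v / z)))) (at z)"
      by (rule has_derivative_compose[OF d2 d3])
    then have "(g has_derivative
        (\<lambda>v. exp (H (Ln z)) * (a (Ln z) * (v / z) + b (Ln z) * cnj (v / z)))) (at z)"
      by (rule has_derivative_transform_within_open[where s = "- {0}"]) (use z branch[OF z(1), symmetric] in auto)
    also have "exp (H (Ln z)) = g z" using branch[of z z] z by simp
    also have "(\<lambda>v. g z * (a (Ln z) * (v / z) + b (Ln z) * cnj (v / z))) = (\<lambda>v. A z * v + B z * cnj v)"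
      by (auto simp: A_def B_def fun_eq_iff algebra_simps)
    finally show "(g has_derivative (\<lambda>v. A z * v + B z * cnj v)) (at z)" .
    have "norm (g z) * norm (b (Ln z)) / norm z \<le> norm (g z) * (k * norm (a (Ln z))) / norm z"
      using ab(2)[OF z(2)] by (intro divide_right_mono mult_left_mono) auto
    then show "norm (B z) \<le> k * norm (A z)"
      by (simp add: A_def B_def norm_mult norm_divide mult_ac)
  next
    fix C assume C: "compact C" "C \<subseteq> U"
    obtain M where M: "0 \<le> M" "\<And>z. z \<in> C \<Longrightarrow> norm (g z) \<le> M"
      using compact_norm_bound[OF continuous_on_subset[OF cont C(2)] C(1)] by blast
    have "(norm (A z) + norm (B z)) * norm z \<le> M * (2 * L)" if "z \<in> C - insert 0 E" for z
    proof -
      have z: "z \<noteq> 0" "exp (Ln z) \<notin> E" using that by auto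
      then have "(norm (A z) + norm (B z)) * norm z = norm (g z) * (norm (a (Ln z)) + norm (b (Ln z)))"
        by (simp add: A_def B_def norm_mult norm_divide field_simps)
      also have "\<dots> \<le> M * (2 * L)" using M that ab_le[OF z(2)] L by (intro mult_mono) auto
      finally show ?thesis .
    qed
    then show "\<exists>M. \<forall>z\<in>C - insert 0 E. (norm (A z) + norm (B z)) * norm z \<le> M" by blast
    have "norm (g z - g w) * norm z \<le> (4 * M + 2 * M * L) * norm (z - w)" if zw: "z \<in> C" "w \<in> C" for z w
    \<comment> \<open>Points far apart relative to \<open>norm z\<close> are handled by the bound on \<open>g\<close> alone.\<close>
    proof (cases "norm z \<le> 2 * norm (z - w)")
      case True
      have "norm (g z - g w) \<le> 2 * M" using M(2)[OF zw(1)] M(2)[OF zw(2)] norm_triangle_ineq4[of "g z" "g w"] by linarith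
      then have "norm (g z - g w) * norm z \<le> (2 * M) * (2 * norm (z - w))" using True M by (intro mult_mono) auto
      also have "\<dots> \<le> (4 * M + 2 * M * L) * norm (z - w)" using M L by (simp add: algebra_simps)
      finally show ?thesis .
    next
      case False
      then have z: "z \<noteq> 0" and w: "w \<noteq> 0" by auto
      have small: "norm ((w - z) / z) < 1 / 2" using False z by (simp add: norm_divide norm_minus_commute field_simps)
      have eq: "1 + (w - z) / z = w / z" using z by (simp add: field_simps)
      have Ln_le: "norm (Ln (w / z)) \<le> 2 * norm ((w - z) / z)"
        using norm_Ln_le[OF small] unfolding eq .
      have gz: "g z = exp (H (Ln z))" using branch[of z z] z by simp
      have "norm (g z - g w) \<le> M * norm (H (Ln z) - H (Ln z + Ln (w / z)))"
        using M(2)[OF zw(1)] M(2)[OF zw(2)] unfolding gz branch[OF z w] by (rule norm_exp_diff_le)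
      also have "\<dots> \<le> M * (L * norm (Ln (w / z)))"
        using lipschitz_onD[OF lip, of "Ln z" "Ln z + Ln (w / z)"] M(1)
        by (intro mult_left_mono) (auto simp: dist_norm)
      also have "\<dots> \<le> M * (L * (2 * norm ((w - z) / z)))" using M(1) L Ln_le by (intro mult_left_mono) auto
      finally have "norm (g z - g w) * norm z \<le> M * (L * (2 * norm ((w - z) / z))) * norm z"
        by (rule mult_right_mono) simp
      also have "\<dots> = 2 * M * L * norm (z - w)" using z by (simp add: norm_divide norm_minus_commute)
      also have "\<dots> \<le> (4 * M + 2 * M * L) * norm (z - w)" using M by (simp add: algebra_simps)
      finally show ?thesis .
    qed
    then show "\<exists>M. \<forall>z\<in>C. \<forall>w\<in>C. norm (g z - g w) * norm z \<le> M * norm (z - w)" by blast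
  qed (fact U cont)+
qed

section \<open>Preservation of orientation\<close>

text \<open>After the substitution \<open>w = g z\<close> the integral of the winding number becomes the Cauchy integral at \<open>z0\<close>
  of the quotient of \<open>deriv g\<close> by the difference quotient \<open>Q\<close> of \<open>g\<close>. That quotient is holomorphic because
  injectivity keeps \<open>Q\<close> away from zero, and its value at \<open>z0\<close> is \<open>1\<close>.\<close>

lemma winding_number_injective_holomorphic_circle:
  assumes holo: "g holomorphic_on ball z0 e" and inj: "inj_on g (ball z0 e)" and r: "0 < r" "r < e"
  shows "winding_number (g \<circ> circlepath z0 r) (g z0) = 1"
proof -
  define S where "S = ball z0 e"
  define Q where "Q = (\<lambda>z. if z = z0 then deriv g z0 else (g z - g z0) / (z - z0))"
  have z0: "z0 \<in> S" using r by (simp add: S_def)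
  have cb: "cball z0 r \<subseteq> S" using r by (auto simp: S_def)
  have Q: "Q holomorphic_on S" unfolding Q_def using holo by (intro pole_lemma_open) (auto simp: S_def)
  have Q0: "Q z \<noteq> 0" if "z \<in> S" for z
    using that z0 inj holomorphic_injective_imp_regular[OF holo _ inj] by (auto simp: Q_def S_def inj_on_def)
  have P: "(\<lambda>z. deriv g z / Q z) holomorphic_on S"
    using Q Q0 holo by (intro holomorphic_intros holomorphic_deriv) (auto simp: S_def)
  have img: "path_image (circlepath z0 r) \<subseteq> S" using cb r by (auto simp: path_image_circlepath)
  have ne: "g z0 \<notin> path_image (g \<circ> circlepath z0 r)"
  proof
    assume "g z0 \<in> path_image (g \<circ> circlepath z0 r)"
    then obtain w where w: "w \<in> path_image (circlepath z0 r)" "g w = g z0"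
      by (auto simp: path_image_compose)
    then have "w = z0" using inj img z0 by (auto simp: inj_on_def S_def)
    then show False using w r by (auto simp: path_image_circlepath)
  qed
  have an: "g analytic_on S" using holo by (simp add: S_def analytic_on_open)
  have vp: "valid_path (g \<circ> circlepath z0 r)"
    by (rule valid_path_compose_holomorphic[OF _ holo]) (use img in \<open>auto simp: S_def\<close>)
  have "contour_integral (g \<circ> circlepath z0 r) (\<lambda>w. 1 / (w - g z0))
      = contour_integral (circlepath z0 r) (\<lambda>w. deriv g w * (1 / (g w - g z0)))"
    by (rule contour_integral_comp_analyticW[OF an _ img]) simp
  also have "\<dots> = contour_integral (circlepath z0 r) (\<lambda>w. (deriv g w / Q w) / (w - z0))"
    by (rule contour_integral_cong) (use r in \<open>auto simp: path_image_circlepath Q_def\<close>)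
  also have "\<dots> = 2 * of_real pi * \<i> * (deriv g z0 / Q z0)"
    by (rule contour_integral_unique, rule Cauchy_integral_circlepath_simple)
       (use r holomorphic_on_subset[OF P cb] in auto)
  also have "\<dots> = 2 * of_real pi * \<i>" using Q0[OF z0] by (simp add: Q_def)
  finally show ?thesis using winding_number_valid_path[OF vp ne] by simp
qed

text \<open>Injectivity of \<open>g\<close> keeps the image of each circle away from the image of its center, so moving the
  circle is a homotopy of loops in the punctured plane.\<close>

lemma winding_number_moving_circle:
  fixes c :: "real \<Rightarrow> complex" and R :: "real \<Rightarrow> real"
  assumes cont: "continuous_on U g" and inj: "inj_on g U"
    and c: "continuous_on {0..1} c" and R: "continuous_on {0..1} R"
    and sub: "\<And>t. t \<in> {0..1} \<Longrightarrow> 0 < R t \<and> cball (c t) (R t) \<subseteq> U"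
  shows "winding_number (g \<circ> circlepath (c 0) (R 0)) (g (c 0))
       = winding_number (g \<circ> circlepath (c 1) (R 1)) (g (c 1))"
proof -
  define h where "h = (\<lambda>(t, s). g (c t + of_real (R t) * exp (2 * of_real pi * \<i> * of_real s)) - g (c t))"
  have mem: "c t + of_real (R t) * exp (2 * of_real pi * \<i> * of_real s) \<in> cball (c t) (R t)"
    if "t \<in> {0..1}" for t s
    using sub[OF that] by (simp add: dist_norm norm_mult norm_exp_eq_Re)
  have "homotopic_loops (- {0}) (\<lambda>s. h (0, s)) (\<lambda>s. h (1, s))"
    unfolding homotopic_loops
  proof (intro exI[of _ h] conjI ballI)
    have c': "continuous_on ({0..1} \<times> {0..1}) (\<lambda>x::real \<times> real. c (fst x))"
      by (rule continuous_on_compose2[where f = fst, OF c continuous_on_fst[OF continuous_on_id]]) auto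
    have R': "continuous_on ({0..1} \<times> {0..1}) (\<lambda>x::real \<times> real. R (fst x))"
      by (rule continuous_on_compose2[where f = fst, OF R continuous_on_fst[OF continuous_on_id]]) auto
    have "continuous_on ({0..1} \<times> {0..1}) (\<lambda>x. g (c (fst x) + of_real (R (fst x)) * exp (2 * of_real pi * \<i> * of_real (snd x))))"
    proof (rule continuous_on_compose2[OF cont, where f = "\<lambda>x. c (fst x) + of_real (R (fst x)) * exp (2 * of_real pi * \<i> * of_real (snd x))"])
      show "(\<lambda>x. c (fst x) + of_real (R (fst x)) * exp (2 * of_real pi * \<i> * of_real (snd x))) ` ({0..1} \<times> {0..1}) \<subseteq> U"
      proof (rule image_subsetI)
        fix x :: "real \<times> real" assume "x \<in> {0..1} \<times> {0..1}"
        then have t: "fst x \<in> {0..1}" by auto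
        show "c (fst x) + of_real (R (fst x)) * exp (2 * of_real pi * \<i> * of_real (snd x)) \<in> U"
          using mem[OF t, of "snd x"] sub[OF t] by blast
      qed
      have "continuous_on ({0..1} \<times> {0..1}) (\<lambda>x::real \<times> real. exp (2 * complex_of_real pi * \<i> * of_real (snd x)))"
        by (intro continuous_intros)
      then show "continuous_on ({0..1} \<times> {0..1}) (\<lambda>x. c (fst x) + of_real (R (fst x)) * exp (2 * of_real pi * \<i> * of_real (snd x)))"
        by (rule continuous_on_add[OF c' continuous_on_mult[OF continuous_on_of_real[OF R']]])
    qed
    moreover have "continuous_on ({0..1} \<times> {0..1}) (\<lambda>x::real \<times> real. g (c (fst x)))"
    proof (rule continuous_on_compose2[OF cont c'], rule image_subsetI)
      fix x :: "real \<times> real" assume "x \<in> {0..1} \<times> {0..1}"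
      then have t: "fst x \<in> {0..1}" by auto
      show "c (fst x) \<in> U" using sub[OF t] by (meson centre_in_cball less_imp_le subsetD)
    qed
    ultimately show "continuous_on ({0..1} \<times> {0..1}) h"
      unfolding h_def case_prod_beta by (rule continuous_on_diff)
    show "h \<in> ({0..1} \<times> {0..1}) \<rightarrow> - {0}"
    proof (clarsimp simp: h_def)
      fix t s :: real
      assume t: "0 \<le> t" "t \<le> 1"
        and eq: "g (c t + of_real (R t) * exp (2 * of_real pi * \<i> * of_real s)) = g (c t)"
      have s: "0 < R t" "cball (c t) (R t) \<subseteq> U" using sub[of t] t by auto
      have "c t + of_real (R t) * exp (2 * of_real pi * \<i> * of_real s) = c t"
        by (rule inj_onD[OF inj eq]) (use s mem[of t s] t in \<open>auto simp: less_imp_le\<close>)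
      then show False using s(1) by simp
    qed
    show "pathfinish (h \<circ> Pair t) = pathstart (h \<circ> Pair t)" for t
      by (simp add: pathfinish_def pathstart_def h_def exp_eq_1)
  qed auto
  then have "winding_number (\<lambda>s. h (0, s)) 0 = winding_number (\<lambda>s. h (1, s)) 0"
    by (rule winding_number_homotopic_loops)
  moreover have "winding_number (g \<circ> circlepath (c t) (R t)) (g (c t)) = winding_number (\<lambda>s. h (t, s)) 0" for t
    by (subst winding_number_offset) (simp add: h_def circlepath o_def)
  ultimately show ?thesis by simp
qed

text \<open>The local degree does not change along a connected domain, so that it suffices to know it on one disc
  where \<open>g\<close> is holomorphic.\<close>

lemma orientation_preserving_onI:
  assumes U: "open U" "connected U" and cont: "continuous_on U g" and inj: "inj_on g U"
    and e: "0 < e" "ball z0 e \<subseteq> U" and holo: "g holomorphic_on ball z0 e"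
  shows "orientation_preserving_on U g"
  unfolding orientation_preserving_on_def
proof (intro allI impI, elim conjE)
  fix z r assume r: "0 < r" "cball z r \<subseteq> U"
  have z: "z \<in> U" "z0 \<in> U" using r e by auto
  obtain p where p: "path p" "path_image p \<subseteq> U" "pathstart p = z0" "pathfinish p = z"
    using connected_open_path_connected[OF U] z unfolding path_connected_def by blast
  obtain d where d: "0 < d" "(\<Union>x\<in>path_image p. cball x d) \<subseteq> U"
    using compact_subset_open_imp_cball_epsilon_subset[OF compact_path_image[OF p(1)] U(1) p(2)] by blast
  \<comment> \<open>A radius small enough for the disc at \<open>z0\<close>, for the whole path, and for the given circle.\<close>
  define \<rho> where "\<rho> = min (min d r) (e / 2)"
  have \<rho>: "0 < \<rho>" "\<rho> \<le> d" "\<rho> \<le> r" "\<rho> < e" using d r e by (auto simp: \<rho>_def)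
  have "1 = winding_number (g \<circ> circlepath z0 \<rho>) (g z0)"
    using winding_number_injective_holomorphic_circle[OF holo inj_on_subset[OF inj e(2)] \<rho>(1,4)] by simp
  also have "\<dots> = winding_number (g \<circ> circlepath (p 0) \<rho>) (g (p 0))"
    using p by (simp add: pathstart_def)
  also have "\<dots> = winding_number (g \<circ> circlepath (p 1) \<rho>) (g (p 1))"
  proof (rule winding_number_moving_circle[OF cont inj, where R = "\<lambda>_. \<rho>"])
    fix t :: real assume "t \<in> {0..1}"
    then have "p t \<in> path_image p" by (auto simp: path_image_def)
    then have "cball (p t) d \<subseteq> U" using d by blast
    then show "0 < \<rho> \<and> cball (p t) \<rho> \<subseteq> U" using \<rho> by (meson order_trans subset_cball)
  qed (use p in \<open>auto simp: path_def\<close>)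
  also have "\<dots> = winding_number (g \<circ> circlepath z \<rho>) (g z)"
    using p by (simp add: pathfinish_def)
  also have "\<dots> = winding_number (g \<circ> circlepath z r) (g z)"
  proof -
    have "0 < (1 - t) * \<rho> + t * r \<and> cball z ((1 - t) * \<rho> + t * r) \<subseteq> U" if "t \<in> {0..1}" for t
    proof -
      have "0 < (1 - t) * \<rho> + t * r"
        using that \<rho> r by (cases "t = 1") (auto intro: add_pos_nonneg)
      moreover have "(1 - t) * \<rho> + t * r \<le> (1 - t) * r + t * r"
        using that \<rho> by (intro add_mono mult_left_mono) auto
      then have "(1 - t) * \<rho> + t * r \<le> r" by (simp add: algebra_simps)
      then have "cball z ((1 - t) * \<rho> + t * r) \<subseteq> cball z r" by (rule subset_cball)
      ultimately show ?thesis using r(2) by blast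
    qed
    then show ?thesis
      using winding_number_moving_circle[OF cont inj continuous_on_const[of _ z],
          of "\<lambda>t. (1 - t) * \<rho> + t * r"]
      by (simp add: continuous_on_add continuous_on_mult continuous_on_diff)
  qed
  finally show "winding_number (g \<circ> circlepath z r) (g z) = 1" by simp
qed

section \<open>The disc and its spiral direction\<close>

text \<open>After division by \<open>s\<close> the disc \<open>cball c r\<close> lies in the disc of all \<open>w\<close> with
  \<open>norm (1 - w) \<le> k * norm (1 + w)\<close>. This is an Apollonius disc: a diameter of it is the real interval
  from \<open>(1 - k) / (1 + k)\<close> to \<open>(1 + k) / (1 - k)\<close>. Thus \<open>s\<close> has the argument of \<open>c\<close>, and its modulus is the
  geometric mean of the least and the greatest modulus in \<open>cball c r\<close>. This is why a bound on the square
  root of the ratio of the moduli is enough.\<close>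

lemma disk_apollonius_center:
  fixes c :: complex and k r :: real
  assumes k: "0 \<le> k" "k < 1" and r: "0 \<le> r" "r < norm c"
    and ratio: "r * (1 + k\<^sup>2) \<le> 2 * k * norm c"
  obtains s where
    "\<And>\<beta>. \<beta> \<in> cball c r \<Longrightarrow> norm (s - \<beta>) \<le> k * norm (s + \<beta>)"
    "\<And>\<beta>. \<beta> \<in> cball c r \<Longrightarrow> 0 < Re (cnj s * \<beta>)"
proof -
  define R where "R = norm c"
  define \<sigma> where "\<sigma> = sqrt (R\<^sup>2 - r\<^sup>2)"
  define u where "u = c / of_real R"
  define s where "s = u * of_real \<sigma>"
  have R: "0 < R" "r < R" using r by (auto simp: R_def)
  have r2: "r\<^sup>2 < R\<^sup>2" using r R by (intro power_strict_mono) auto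
  have \<sigma>2: "\<sigma>\<^sup>2 = R\<^sup>2 - r\<^sup>2" using r2 by (simp add: \<sigma>_def)
  have \<sigma>: "0 < \<sigma>" using r2 by (simp add: \<sigma>_def)
  have cu: "c = u * of_real R" using R by (simp add: u_def)
  have nu: "norm u = 1" using R by (simp add: u_def norm_divide R_def)
  have key: "R * (1 - k\<^sup>2) \<le> \<sigma> * (1 + k\<^sup>2)"
  proof (rule power2_le_imp_le)
    have "(r * (1 + k\<^sup>2))\<^sup>2 \<le> (2 * k * R)\<^sup>2"
      using ratio r k by (intro power_mono) (auto simp: R_def)
    then have "(R * (1 - k\<^sup>2))\<^sup>2 \<le> (R\<^sup>2 - r\<^sup>2) * (1 + k\<^sup>2)\<^sup>2"
      by (simp add: power2_eq_square algebra_simps)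
    then show "(R * (1 - k\<^sup>2))\<^sup>2 \<le> (\<sigma> * (1 + k\<^sup>2))\<^sup>2" by (simp add: power_mult_distrib \<sigma>2)
  qed (use \<sigma> in auto)
  have main: "norm (s - \<beta>) \<le> k * norm (s + \<beta>) \<and> 0 < Re (cnj s * \<beta>)" if \<beta>: "\<beta> \<in> cball c r" for \<beta>
  proof -
    define b where "b = \<beta> * cnj u"
    have uu: "u * cnj u = 1" using nu by (simp add: complex_norm_square[symmetric])
    have \<beta>b: "\<beta> = u * b" using uu by (simp add: b_def mult_ac)
    have "norm (u * (of_real R - b)) \<le> r" using \<beta> unfolding mem_cball dist_norm cu \<beta>b by (simp add: algebra_simps)
    then have "norm (of_real R - b) \<le> r" by (simp add: norm_mult nu)
    then have "(norm (of_real R - b))\<^sup>2 \<le> r\<^sup>2" by (intro power_mono) auto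
    then have "(R - Re b)\<^sup>2 + (Im b)\<^sup>2 \<le> r\<^sup>2" by (simp add: cmod_power2)
    \<comment> \<open>The rotated disc, with center \<open>R\<close>, as an Apollonius condition.\<close>
    then have N: "(Re b)\<^sup>2 + (Im b)\<^sup>2 + \<sigma>\<^sup>2 \<le> 2 * R * Re b"
      unfolding \<sigma>2 by (simp add: power2_eq_square algebra_simps)
    have "0 < \<sigma>\<^sup>2" using \<sigma> by simp
    then have "0 < 2 * R * Re b" using N by (smt (verit) zero_le_power2)
    then have Reb: "0 < Re b" using R by (simp add: zero_less_mult_iff)
    have "(norm (of_real \<sigma> - b))\<^sup>2 \<le> (k * norm (of_real \<sigma> + b))\<^sup>2"
    proof -
      let ?N = "(Re b)\<^sup>2 + (Im b)\<^sup>2 + \<sigma>\<^sup>2"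
      have "(1 - k\<^sup>2) * ?N \<le> (1 - k\<^sup>2) * (2 * R * Re b)"
        using N k by (intro mult_left_mono) (auto simp: power_le_one)
      also have "\<dots> = (R * (1 - k\<^sup>2)) * (2 * Re b)" by simp
      also have "\<dots> \<le> (\<sigma> * (1 + k\<^sup>2)) * (2 * Re b)" using key Reb by (intro mult_right_mono) auto
      finally have "(1 - k\<^sup>2) * ?N \<le> (\<sigma> * (1 + k\<^sup>2)) * (2 * Re b)" .
      then show ?thesis by (simp add: power_mult_distrib cmod_power2) (simp add: power2_eq_square algebra_simps)
    qed
    then have "norm (of_real \<sigma> - b) \<le> k * norm (of_real \<sigma> + b)"
      using k by (meson mult_nonneg_nonneg norm_ge_zero power2_le_imp_le)
    moreover have "s - \<beta> = u * (of_real \<sigma> - b)" "s + \<beta> = u * (of_real \<sigma> + b)"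
      by (simp_all add: s_def \<beta>b algebra_simps)
    ultimately have "norm (s - \<beta>) \<le> k * norm (s + \<beta>)" by (simp add: norm_mult nu)
    moreover have "cnj s * \<beta> = (u * cnj u) * (of_real \<sigma> * b)" by (simp add: s_def \<beta>b mult_ac)
    then have "0 < Re (cnj s * \<beta>)" using uu \<sigma> Reb by simp
    ultimately show ?thesis by blast
  qed
  then show thesis using that by blast
qed

text \<open>The greatest and the least modulus in the disc are \<open>norm c + r\<close> and \<open>norm c - r\<close>, both attained on the
  line through \<open>0\<close> and \<open>c\<close>.\<close>

lemma disk_modulus_ratio:
  fixes c :: complex
  assumes k: "0 \<le> k" "k < 1" and K: "K = (1 + k) / (1 - k)" and r: "0 \<le> r"
    and sub: "cball c r \<subseteq> - {0}" and ratio: "\<forall>w\<in>cball c r. \<forall>z\<in>cball c r. sqrt (norm (w / z)) \<le> K"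
  shows "r < norm c" "r * (1 + k\<^sup>2) \<le> 2 * k * norm c"
proof -
  show rc: "r < norm c"
  proof (rule ccontr)
    assume "\<not> r < norm c"
    then have "0 \<in> cball c r" by (simp add: dist_norm)
    then show False using sub by auto
  qed
  define R where "R = norm c"
  have R: "0 < R" "r < R" using rc r by (auto simp: R_def)
  have c: "c \<noteq> 0" using R by (auto simp: R_def)
  define w where "w = c * of_real (1 + r / R)"
  define z where "z = c * of_real (1 - r / R)"
  have "w \<in> cball c r" "z \<in> cball c r"
    using R r by (auto simp: w_def z_def dist_norm algebra_simps norm_mult norm_divide R_def)
  then have "sqrt (norm (w / z)) \<le> K" using ratio by blast
  moreover have "norm (w / z) = (R + r) / (R - r)"
  proof -
    have "norm w = R * \<bar>1 + r / R\<bar>" "norm z = R * \<bar>1 - r / R\<bar>"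
      unfolding w_def z_def norm_mult norm_of_real R_def by simp_all
    moreover have "\<bar>1 + r / R\<bar> = 1 + r / R" "\<bar>1 - r / R\<bar> = 1 - r / R"
      using R r by (auto simp: abs_of_nonneg)
    ultimately have "norm w = R + r" "norm z = R - r"
      using R by (simp_all add: distrib_left right_diff_distrib)
    then show ?thesis by (simp add: norm_divide)
  qed
  ultimately have "sqrt ((R + r) / (R - r)) \<le> K" by simp
  then have "(R + r) / (R - r) \<le> K\<^sup>2"
    using R r by (metis real_sqrt_le_iff real_sqrt_unique sqrt_le_D)
  then have "(R + r) / (R - r) \<le> (1 + k)\<^sup>2 / (1 - k)\<^sup>2" by (simp add: K power_divide)
  then have "(R + r) * (1 - k)\<^sup>2 \<le> (1 + k)\<^sup>2 * (R - r)"
    using R k by (simp add: divide_simps split: if_splits)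
  then show "r * (1 + k\<^sup>2) \<le> 2 * k * norm c"
    by (simp add: R_def[symmetric] power2_eq_square algebra_simps)
qed

section \<open>The logarithmic lift\<close>

text \<open>In the coordinate \<open>\<zeta> = ln z\<close> the function \<open>z * deriv f z / f z\<close> is the derivative of the lift
  \<open>ln (f (exp \<zeta>))\<close>. That it stays within distance \<open>r\<close> of \<open>c\<close> says that the lift minus \<open>c * \<zeta>\<close> is
  \<open>r\<close>-Lipschitz on the convex half plane; this function \<open>h\<close> therefore extends to the closed half plane with
  the same constant. The value \<open>1\<close> belongs to the closed disc as the limit of \<open>z * deriv f z / f z\<close> at the
  origin.\<close>

lemma logarithmic_lift:
  fixes f :: "complex \<Rightarrow> complex"
  assumes holo: "f holomorphic_on ball 0 1" and f0: "f 0 = 0" and df0: "deriv f 0 \<noteq> 0"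
    and r: "0 \<le> r"
    and B: "\<And>z. z \<in> ball 0 1 - {0} \<Longrightarrow> f z \<noteq> 0 \<and> z * deriv f z / f z \<in> cball c r"
  obtains h where "r-lipschitz_on {\<zeta>. Re \<zeta> \<le> 0} h" "h holomorphic_on {\<zeta>. Re \<zeta> < 0}"
    "\<And>\<zeta>. Re \<zeta> < 0 \<Longrightarrow> exp (c * \<zeta> + h \<zeta>) = f (exp \<zeta>)"
    "\<And>\<zeta>. Re \<zeta> \<le> 0 \<Longrightarrow> h (\<zeta> + 2 * pi * \<i>) = h \<zeta> + 2 * pi * \<i> * (1 - c)"
    "1 \<in> cball c r"
proof -
  define D where "D = ball (0::complex) 1"
  define u where "u = (\<lambda>z. if z = 0 then deriv f 0 else (f z - f 0) / (z - 0))"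
  have u: "u holomorphic_on D" unfolding u_def D_def by (intro pole_lemma_open holo) simp
  have u0: "u z \<noteq> 0" if "z \<in> D" for z using that B[of z] f0 df0 by (auto simp: u_def D_def)
  obtain l where l: "l holomorphic_on D" "\<And>z. z \<in> D \<Longrightarrow> exp (l z) = u z"
    using holomorphic_logarithm_exists[OF _ _ u u0, of 0] by (auto simp: D_def)
  have fl: "f z = z * exp (l z)" if "z \<in> D" for z using l(2)[OF that] f0 by (simp add: u_def)
  have dl: "(l has_field_derivative deriv l z) (at z)" if "z \<in> D" for z
    using l(1) that by (simp add: D_def holomorphic_derivI)
  have P: "1 + z * deriv l z \<in> cball c r" if "z \<in> D - {0}" for z
  proof -
    have "((\<lambda>z. z * exp (l z)) has_field_derivative exp (l z) * (1 + z * deriv l z)) (at z)"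
      using that by (auto intro!: derivative_eq_intros dl simp: algebra_simps)
    then have "(f has_field_derivative exp (l z) * (1 + z * deriv l z)) (at z)"
      by (rule has_field_derivative_transform_within_open[where S = D]) (use that fl in \<open>auto simp: D_def\<close>)
    then have "deriv f z = exp (l z) * (1 + z * deriv l z)" by (rule DERIV_imp_deriv)
    then have "z * deriv f z / f z = 1 + z * deriv l z" using that fl[of z] by simp
    then show ?thesis using B[of z] that by (simp add: D_def)
  qed
  have "1 + 0 * deriv l 0 \<in> cball c r"
  proof (rule Lim_in_closed_set[of _ "\<lambda>z. 1 + z * deriv l z" "at 0"])
    have "\<forall>\<^sub>F z in at 0. z \<in> D - {0}"
      unfolding D_def eventually_at by (rule exI[of _ 1]) (simp add: dist_norm)
    then show "\<forall>\<^sub>F z in at 0. 1 + z * deriv l z \<in> cball c r"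
      by eventually_elim (rule P)
    have "deriv l holomorphic_on D" using l(1) by (simp add: D_def holomorphic_deriv)
    then have "continuous_on D (deriv l)" by (rule holomorphic_on_imp_continuous_on)
    then have "isCont (deriv l) 0" by (simp add: D_def continuous_on_eq_continuous_at)
    then show "((\<lambda>z. 1 + z * deriv l z) \<longlongrightarrow> 1 + 0 * deriv l 0) (at 0)"
      by (intro tendsto_intros) (simp_all add: isCont_def)
  qed auto
  then have one: "1 \<in> cball c r" by simp
  define h0 where "h0 = (\<lambda>\<zeta>. \<zeta> + l (exp \<zeta>) - c * \<zeta>)"
  define H where "H = {\<zeta>. Re \<zeta> < 0}"
  have expD: "exp \<zeta> \<in> D - {0}" if "\<zeta> \<in> H" for \<zeta> using that by (simp add: D_def H_def norm_exp_eq_Re)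
  have dh: "(h0 has_field_derivative 1 + exp \<zeta> * deriv l (exp \<zeta>) - c) (at \<zeta>)" if "\<zeta> \<in> H" for \<zeta>
    unfolding h0_def using expD[OF that]
    by (auto intro!: derivative_eq_intros DERIV_chain2[OF dl])
  have "r-lipschitz_on H h0"
  proof (rule lipschitz_onI)
    fix x y assume xy: "x \<in> H" "y \<in> H"
    have "norm (h0 x - h0 y) \<le> r * norm (x - y)"
    proof (rule field_differentiable_bound[where S = H and f' = "\<lambda>\<zeta>. 1 + exp \<zeta> * deriv l (exp \<zeta>) - c"])
      show "convex H" unfolding H_def by (rule convex_halfspace_Re_lt)
      show "(h0 has_field_derivative 1 + exp z * deriv l (exp z) - c) (at z within H)" if "z \<in> H" for z
        using dh[OF that] by (rule has_field_derivative_at_within)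
      show "norm (1 + exp z * deriv l (exp z) - c) \<le> r" if "z \<in> H" for z
        using P[OF expD[OF that]] by (simp add: dist_norm norm_minus_commute)
    qed (use xy in auto)
    then show "dist (h0 x) (h0 y) \<le> r * dist x y" by (simp add: dist_norm)
  qed (rule r)
  then obtain h where h: "r-lipschitz_on (closure H) h" "\<And>x. x \<in> H \<Longrightarrow> h x = h0 x"
    using lipschitz_extend_closure by metis
  have clH: "closure H = {\<zeta>. Re \<zeta> \<le> 0}"
    using closure_halfspace_lt[of "1::complex" 0] by (simp add: H_def inner_complex_def)
  show thesis
  proof
    show "r-lipschitz_on {\<zeta>. Re \<zeta> \<le> 0} h" using h(1) by (simp only: clH)
    have "h0 holomorphic_on H" unfolding holomorphic_on_def
      using dh field_differentiable_at_within field_differentiable_def by blast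
    then show "h holomorphic_on {\<zeta>. Re \<zeta> < 0}"
      using holomorphic_transform[of h0 H h] h(2) by (simp add: H_def)
    show "exp (c * \<zeta> + h \<zeta>) = f (exp \<zeta>)" if "Re \<zeta> < 0" for \<zeta>
    proof -
      have "\<zeta> \<in> H" using that by (simp add: H_def)
      then have "c * \<zeta> + h \<zeta> = \<zeta> + l (exp \<zeta>)" "exp \<zeta> \<in> D" using h(2) expD by (auto simp: h0_def)
      then show ?thesis using fl by (simp add: exp_add)
    qed
    have cont: "continuous_on {\<zeta>. Re \<zeta> \<le> 0} h"
      using h(1) by (simp add: clH lipschitz_on_continuous_on)
    show "h (\<zeta> + 2 * pi * \<i>) = h \<zeta> + 2 * pi * \<i> * (1 - c)" if "Re \<zeta> \<le> 0" for \<zeta>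
    proof -
      have "h (\<zeta> + 2 * pi * \<i>) - h \<zeta> = 2 * pi * \<i> * (1 - c)"
      proof (rule continuous_constant_on_closure[of H "\<lambda>\<zeta>. h (\<zeta> + 2 * pi * \<i>) - h \<zeta>"])
        have "continuous_on (closure H) (\<lambda>\<zeta>. h (\<zeta> + 2 * pi * \<i>))"
          by (rule continuous_on_compose2[OF cont]) (auto intro!: continuous_intros simp: clH)
        then show "continuous_on (closure H) (\<lambda>\<zeta>. h (\<zeta> + 2 * pi * \<i>) - h \<zeta>)"
          using cont by (simp add: clH continuous_on_diff)
        show "h (x + 2 * pi * \<i>) - h x = 2 * pi * \<i> * (1 - c)" if "x \<in> H" for x
        proof -
          have "x + 2 * pi * \<i> \<in> H" using that by (simp add: H_def)
          from h(2)[OF this] h(2)[OF that] show ?thesis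
            by (simp add: h0_def exp_add exp_two_pi_i) (simp add: algebra_simps)
        qed
      qed (use that clH in auto)
      then show ?thesis by (simp add: algebra_simps)
    qed
  qed (rule one)
qed

section \<open>The spiral extension\<close>

lemma negligible_UNIV_Times:
  assumes "negligible (N :: real set)"
  shows "negligible ((UNIV :: real set) \<times> N)"
proof -
  have "N \<in> null_sets lebesgue" using assms by (simp add: negligible_iff_null_sets)
  then obtain N' where N': "N' \<in> null_sets lborel" "N \<subseteq> N'" by (auto simp: null_sets_completion_iff2)
  have "(UNIV :: real set) \<times> N' \<in> null_sets (lborel \<Otimes>\<^sub>M lborel)"
    by (rule sigma_finite_measure.times_in_null_sets2[OF sigma_finite_lborel]) (use N' in auto)
  then have "(UNIV :: real set) \<times> N' \<in> null_sets lborel" by (simp add: lborel_prod)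
  then have "negligible ((UNIV :: real set) \<times> N')"
    by (simp add: negligible_iff_null_sets null_sets_completionI)
  then show ?thesis by (rule negligible_subset) (use N' in auto)
qed

text \<open>The data on which the extension is built: the lift \<open>c * \<zeta> + h \<zeta>\<close> of \<open>f\<close> in the left half plane, and the
  spiral direction \<open>s\<close>, seen from which every value \<open>\<beta>\<close> of the derivative of the lift has dilatation at
  most \<open>k\<close>.\<close>

locale half_plane_lift =
  fixes c s :: complex and r k :: real and h f :: "complex \<Rightarrow> complex"
  assumes lip: "r-lipschitz_on {\<zeta>. Re \<zeta> \<le> 0} h"
    and holo: "h holomorphic_on {\<zeta>. Re \<zeta> < 0}"
    and period: "\<And>\<zeta>. Re \<zeta> \<le> 0 \<Longrightarrow> h (\<zeta> + 2 * pi * \<i>) = h \<zeta> + 2 * pi * \<i> * (1 - c)"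
    and k: "0 \<le> k"
    and dil: "\<And>\<beta>. \<beta> \<in> cball c r \<Longrightarrow> norm (s - \<beta>) \<le> k * norm (s + \<beta>)"
    and pos: "\<And>\<beta>. \<beta> \<in> cball c r \<Longrightarrow> 0 < Re (cnj s * \<beta>)"
    and one: "1 \<in> cball c r"
    and f_holo: "f holomorphic_on ball 0 1" and f0: "f 0 = 0"
    and lift: "\<And>\<zeta>. Re \<zeta> < 0 \<Longrightarrow> exp (c * \<zeta> + h \<zeta>) = f (exp \<zeta>)"
begin

definition left_retract :: "complex \<Rightarrow> complex" where
  "left_retract \<zeta> = Complex (min 0 (Re \<zeta>)) (Im \<zeta>)"

definition log_f :: "complex \<Rightarrow> complex" where "log_f \<zeta> = c * \<zeta> + h \<zeta>"

text \<open>The extension in logarithmic coordinates: the lift of \<open>f\<close> for \<open>Re \<zeta> \<le> 0\<close>, and beyond the imaginary axis the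
  boundary values carried along the straight line in the direction \<open>s\<close>. In the plane this sends
  \<open>t * u\<close> with \<open>norm u = 1 \<le> t\<close> to the boundary value at \<open>u\<close> times \<open>t powr s\<close>, a logarithmic spiral.\<close>

definition log_ext :: "complex \<Rightarrow> complex" where
  "log_ext \<zeta> = s * max 0 (Re \<zeta>) + log_f (left_retract \<zeta>)"

lemma Re_s: "0 < Re s" using pos[OF one] by simp

lemma s_nz: "s \<noteq> 0" using Re_s by auto

lemma r_nonneg: "0 \<le> r" using lip by (rule lipschitz_on_nonneg)

lemma log_ext_left: "Re \<zeta> \<le> 0 \<Longrightarrow> log_ext \<zeta> = log_f \<zeta>"
  by (simp add: log_ext_def left_retract_def min_def max_def complex_eq_iff)

lemma log_ext_right: "0 \<le> Re \<zeta> \<Longrightarrow> log_ext \<zeta> = s * Re \<zeta> + log_f (\<i> * Im \<zeta>)"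
proof -
  assume "0 \<le> Re \<zeta>"
  then have "left_retract \<zeta> = \<i> * Im \<zeta>" by (simp add: left_retract_def complex_eq_iff)
  then show ?thesis using \<open>0 \<le> Re \<zeta>\<close> by (simp add: log_ext_def)
qed

lemma Re_left_retract: "Re (left_retract \<zeta>) \<le> 0" by (simp add: left_retract_def)

lemma log_ext_lipschitz: "(norm s + (norm c + r))-lipschitz_on UNIV log_ext"
proof (rule lipschitz_onI)
  fix x y :: complex
  have 1: "norm (left_retract x - left_retract y) \<le> norm (x - y)"
    unfolding left_retract_def cmod_def
    by (intro real_sqrt_le_mono add_mono) (auto simp: abs_le_square_iff[symmetric])
  have "norm (h (left_retract x) - h (left_retract y)) \<le> r * norm (left_retract x - left_retract y)"
    using lipschitz_onD[OF lip] Re_left_retract by (simp add: dist_norm)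
  also have "\<dots> \<le> r * norm (x - y)" using 1 r_nonneg by (rule mult_left_mono)
  finally have 2: "norm (h (left_retract x) - h (left_retract y)) \<le> r * norm (x - y)" .
  have "\<bar>max 0 (Re x) - max 0 (Re y)\<bar> \<le> \<bar>Re (x - y)\<bar>" by auto
  also have "\<dots> \<le> norm (x - y)" by (rule abs_Re_le_cmod)
  finally have 3: "\<bar>max 0 (Re x) - max 0 (Re y)\<bar> \<le> norm (x - y)" .
  have "log_ext x - log_ext y = s * of_real (max 0 (Re x) - max 0 (Re y)) + (c * (left_retract x - left_retract y)
      + (h (left_retract x) - h (left_retract y)))"
    by (simp add: log_ext_def log_f_def algebra_simps)
  also have "norm \<dots> \<le> norm s * norm (x - y) + (norm c * norm (x - y) + r * norm (x - y))"
    using 1 2 3 unfolding norm_mult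
    by (intro norm_triangle_le add_mono order_trans[OF norm_triangle_ineq])
       (auto simp: norm_mult mult_left_mono simp del: of_real_diff)
  finally show "dist (log_ext x) (log_ext y) \<le> (norm s + (norm c + r)) * dist x y"
    by (simp add: dist_norm algebra_simps)
qed (use r_nonneg in simp)

lemma log_ext_periodic: "log_ext (\<zeta> + 2 * pi * \<i>) = log_ext \<zeta> + 2 * pi * \<i>"
proof -
  have "left_retract (\<zeta> + 2 * pi * \<i>) = left_retract \<zeta> + 2 * pi * \<i>"
    by (simp add: left_retract_def complex_eq_iff)
  then show ?thesis using period[OF Re_left_retract[of \<zeta>]] by (simp add: log_ext_def log_f_def algebra_simps)
qed

lemma log_ext_periodic_int: "log_ext (\<zeta> + of_int n * (2 * pi * \<i>)) = log_ext \<zeta> + of_int n * (2 * pi * \<i>)"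
proof -
  interpret periodic_fun_simple "\<lambda>\<zeta>. log_ext \<zeta> - \<zeta>" "2 * pi * \<i>"
    by unfold_locales (use log_ext_periodic in \<open>simp add: algebra_simps\<close>)
  show ?thesis using plus_of_int[of \<zeta> n] by (simp add: algebra_simps)
qed

text \<open>Every difference quotient of the lift lies in the disc, up to the boundary. This replaces the
  derivative, which need not exist on the imaginary axis.\<close>

lemma log_f_chord:
  assumes "Re x \<le> 0" "Re y \<le> 0"
  obtains \<beta> where "\<beta> \<in> cball c r" "log_f x - log_f y = \<beta> * (x - y)"
proof (cases "x = y")
  case True
  then show thesis using that[of c] r_nonneg by simp
next
  case False
  define \<beta> where "\<beta> = c + (h x - h y) / (x - y)"
  have "norm (h x - h y) \<le> r * norm (x - y)"
    using lipschitz_onD[OF lip, of x y] assms by (simp add: dist_norm)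
  then have "norm ((h x - h y) / (x - y)) \<le> r" using False by (simp add: norm_divide divide_le_eq)
  then have "\<beta> \<in> cball c r" by (simp add: \<beta>_def dist_norm)
  moreover have "log_f x - log_f y = \<beta> * (x - y)" using False by (simp add: \<beta>_def log_f_def field_simps)
  ultimately show thesis by (rule that)
qed

text \<open>If \<open>log_ext x = log_ext y\<close>, then the lift reaches the boundary value over \<open>\<i> * Im y\<close> by going from \<open>x\<close>
  to the right, yet moves by a nonnegative multiple of \<open>- s\<close>. A chord slope \<open>\<beta>\<close> with
  \<open>Re (cnj s * \<beta>) > 0\<close> cannot do that.\<close>

lemma log_ext_no_crossing:
  assumes x: "Re x < 0" and y: "0 \<le> Re y"
  shows "log_ext x \<noteq> log_ext y"
proof
  assume eq: "log_ext x = log_ext y"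
  obtain \<beta> where \<beta>: "\<beta> \<in> cball c r" "log_f (\<i> * Im y) - log_f x = \<beta> * (\<i> * Im y - x)"
    using log_f_chord[of "\<i> * Im y" x] x by auto
  have b: "\<beta> * (\<i> * Im y - x) = - (s * Re y)"
    using eq x y \<beta>(2) by (simp add: log_ext_left log_ext_right)
  have "(cnj \<beta> * \<beta>) * (\<i> * Im y - x) = - (Re y * (cnj \<beta> * s))"
    using arg_cong[OF b, of "\<lambda>w. cnj \<beta> * w"] by (simp add: mult_ac)
  then have "Re ((cnj \<beta> * \<beta>) * (\<i> * Im y - x)) = - (Re y * Re (cnj \<beta> * s))" by simp
  moreover have "Re (cnj \<beta> * s) = Re (cnj s * \<beta>)" by (simp add: mult.commute)
  moreover have "cnj \<beta> * \<beta> = of_real ((norm \<beta>)\<^sup>2)"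
    by (metis complex_norm_square mult.commute)
  ultimately have "(norm \<beta>)\<^sup>2 * (- Re x) = - (Re y * Re (cnj s * \<beta>))" by simp
  moreover have "0 \<le> Re y * Re (cnj s * \<beta>)" using y pos[OF \<beta>(1)] by simp
  moreover have "\<beta> \<noteq> 0" using pos[OF \<beta>(1)] by auto
  then have "0 < (norm \<beta>)\<^sup>2 * (- Re x)" using x by (intro mult_pos_pos) auto
  ultimately show False by linarith
qed

text \<open>On the right half plane two points with the same image have the same imaginary part, because the
  boundary curve is strictly increasing in the direction \<open>\<i> * s\<close>. On the left one the chord slopes are
  nonzero.\<close>

lemma log_ext_inj: "log_ext x = log_ext y \<Longrightarrow> x = y"
proof -
  assume eq: "log_ext x = log_ext y"
  consider "Re x \<le> 0" "Re y \<le> 0" | "0 \<le> Re x" "0 \<le> Re y" | "Re x < 0" "0 \<le> Re y" | "Re y < 0" "0 \<le> Re x"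
    by linarith
  then show "x = y"
  proof cases
    case 1
    then obtain \<beta> where \<beta>: "\<beta> \<in> cball c r" "log_f x - log_f y = \<beta> * (x - y)" using log_f_chord by blast
    moreover have "\<beta> \<noteq> 0" using pos[OF \<beta>(1)] by auto
    ultimately show ?thesis using eq 1 by (simp add: log_ext_left)
  next
    case 2
    obtain \<beta> where \<beta>: "\<beta> \<in> cball c r" "log_f (\<i> * Im x) - log_f (\<i> * Im y) = \<beta> * (\<i> * Im x - \<i> * Im y)"
      using log_f_chord[of "\<i> * Im x" "\<i> * Im y"] by auto
    have "s * (Re x - Re y) + (log_f (\<i> * Im x) - log_f (\<i> * Im y)) = 0"
      using eq 2 by (simp add: log_ext_right algebra_simps)
    then have 0: "s * (Re x - Re y) + \<beta> * (\<i> * (Im x - Im y)) = 0"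
      unfolding \<beta>(2) by (simp add: algebra_simps)
    have "cnj s * s * (Re x - Re y) + (cnj s * \<beta>) * (\<i> * (Im x - Im y)) = 0"
      using arg_cong[OF 0, of "\<lambda>w. cnj s * w"] by (simp add: algebra_simps)
    then have "Im (cnj s * s * (Re x - Re y) + (cnj s * \<beta>) * (\<i> * (Im x - Im y))) = 0" by simp
    moreover have "cnj s * s = of_real ((norm s)\<^sup>2)"
      by (metis complex_norm_square mult.commute)
    ultimately have "Re (cnj s * \<beta>) * (Im x - Im y) = 0" by simp
    then have "Im x = Im y" using pos[OF \<beta>(1)] by auto
    moreover from this have "Re x = Re y" using 0 s_nz by auto
    ultimately show ?thesis by (simp add: complex_eq_iff)
  next
    case 3 then show ?thesis using log_ext_no_crossing eq by blast
  next
    case 4 then show ?thesis using log_ext_no_crossing[of y x] eq by simp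
  qed
qed

text \<open>On the left the map is holomorphic. On the right it is linear in the real part and depends on the
  imaginary part through the Lipschitz boundary curve, which is differentiable off a null set of the
  line. There its differential is \<open>v \<mapsto> s * Re v + \<beta> * \<i> * Im v\<close> with \<open>\<beta>\<close> in the disc, and this has Wirtinger
  coefficients \<open>(s + \<beta>) / 2\<close> and \<open>(s - \<beta>) / 2\<close>.\<close>

lemma log_ext_differentiable_ae:
  obtains E where "negligible E"
    "\<And>\<zeta>. exp \<zeta> \<notin> E \<Longrightarrow> \<exists>a b. (log_ext has_derivative (\<lambda>v. a * v + b * cnj v)) (at \<zeta>) \<and> norm b \<le> k * norm a"
proof -
  define w where "w = (\<lambda>y. h (\<i> * of_real y))"
  have w_lip: "r-lipschitz_on UNIV w"
  proof (rule lipschitz_onI)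
    fix x y :: real
    have "dist (w x) (w y) \<le> r * dist (\<i> * of_real x) (\<i> * of_real y :: complex)"
      unfolding w_def by (rule lipschitz_onD[OF lip]) auto
    also have "dist (\<i> * of_real x) (\<i> * of_real y :: complex) = dist x y"
      by (simp add: dist_norm norm_mult flip: right_diff_distrib of_real_diff)
    finally show "dist (w x) (w y) \<le> r * dist x y" .
  qed (rule r_nonneg)
  obtain N where N: "negligible N" "\<And>y. y \<notin> N \<Longrightarrow> \<exists>d. (w has_vector_derivative d) (at y)"
    using lipschitz_complex_differentiable_ae[OF w_lip] by blast
  \<comment> \<open>The image of the bad horizontal lines and of the imaginary axis under the exponential.\<close>
  define E where "E = sphere 0 1 \<union> (\<lambda>p. exp (Complex (fst p) (snd p))) ` (UNIV \<times> N)"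
  have "negligible ((\<lambda>p. exp (Complex (fst p) (snd p))) ` (UNIV \<times> N))"
  proof (rule negligible_differentiable_image_negligible[OF _ negligible_UNIV_Times[OF N(1)]])
    have "(\<lambda>p. exp (of_real (fst p) + \<i> * of_real (snd p))) differentiable_on UNIV \<times> N"
    proof (rule differentiable_at_imp_differentiable_on)
      fix p :: "real \<times> real"
      show "(\<lambda>p. exp (of_real (fst p) + \<i> * of_real (snd p))) differentiable at p"
        unfolding differentiable_def
        by (rule exI, rule has_derivative_compose[where g = exp])
           (auto intro!: derivative_eq_intros simp: DERIV_exp[unfolded has_field_derivative_def])
    qed
    then show "(\<lambda>p. exp (Complex (fst p) (snd p))) differentiable_on UNIV \<times> N"
      by (simp add: Complex_eq)
  qed simp
  then have "negligible E" unfolding E_def by (intro negligible_Un negligible_sphere)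
  moreover have "\<exists>a b. (log_ext has_derivative (\<lambda>v. a * v + b * cnj v)) (at \<zeta>) \<and> norm b \<le> k * norm a"
    if \<zeta>: "exp \<zeta> \<notin> E" for \<zeta>
  proof -
    have "Re \<zeta> \<noteq> 0" using \<zeta> by (auto simp: E_def norm_exp_eq_Re)
    moreover have "Im \<zeta> \<notin> N"
    proof
      assume "Im \<zeta> \<in> N"
      then have "exp \<zeta> \<in> (\<lambda>p. exp (Complex (fst p) (snd p))) ` (UNIV \<times> N)"
        by (intro image_eqI[where x = "(Re \<zeta>, Im \<zeta>)"]) auto
      then show False using \<zeta> by (simp add: E_def)
    qed
    ultimately consider "Re \<zeta> < 0" | "0 < Re \<zeta>" "Im \<zeta> \<notin> N" by linarith
    then show ?thesis
    proof cases
      case 1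
      have op: "open {\<zeta>. Re \<zeta> < 0}" by (rule open_halfspace_Re_lt)
      have "(h has_field_derivative deriv h \<zeta>) (at \<zeta>)"
        using holo op 1 by (auto intro: holomorphic_derivI)
      then have "(log_f has_field_derivative c + deriv h \<zeta>) (at \<zeta>)"
        unfolding log_f_def by (auto intro!: derivative_eq_intros)
      then have "(log_f has_derivative (\<lambda>v. (c + deriv h \<zeta>) * v + 0 * cnj v)) (at \<zeta>)"
        by (simp add: has_field_derivative_def)
      then have "(log_ext has_derivative (\<lambda>v. (c + deriv h \<zeta>) * v + 0 * cnj v)) (at \<zeta>)"
        by (rule has_derivative_transform_within_open[OF _ op]) (use 1 log_ext_left in auto)
      then show ?thesis using k by (intro exI[of _ "c + deriv h \<zeta>"] exI[of _ 0]) simp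
    next
      case 2
      have op: "open {\<zeta>. 0 < Re \<zeta>}" by (rule open_halfspace_Re_gt)
      obtain d where d: "(w has_vector_derivative d) (at (Im \<zeta>))" using N(2) 2 by blast
      have d': "(w has_derivative (\<lambda>t. t *\<^sub>R d)) (at (Im \<zeta>))"
        using d by (simp add: has_vector_derivative_def)
      have "norm d \<le> r" using lipschitz_has_derivative_bound[OF w_lip d', of 1] by simp
      define \<beta> where "\<beta> = c - \<i> * d"
      have \<beta>: "\<beta> \<in> cball c r" using \<open>norm d \<le> r\<close> by (simp add: \<beta>_def dist_norm norm_mult)
      have "((\<lambda>\<zeta>. w (Im \<zeta>)) has_derivative (\<lambda>v. Im v *\<^sub>R d)) (at \<zeta>)"
        by (rule has_derivative_compose[where f = Im and g = w, OF _ d']) (auto intro: derivative_intros)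
      then have "((\<lambda>\<zeta>. s * Re \<zeta> + (c * (\<i> * Im \<zeta>) + w (Im \<zeta>))) has_derivative
          (\<lambda>v. s * Re v + (c * (\<i> * Im v) + Im v *\<^sub>R d))) (at \<zeta>)"
        by (intro has_derivative_add has_derivative_mult_right has_derivative_of_real has_derivative_Re
            has_derivative_Im has_derivative_ident)
      then have "(log_ext has_derivative (\<lambda>v. s * Re v + (c * (\<i> * Im v) + Im v *\<^sub>R d))) (at \<zeta>)"
        by (rule has_derivative_transform_within_open[OF _ op])
           (use 2 in \<open>auto simp: log_ext_right log_f_def w_def\<close>)
      also have "(\<lambda>v. s * Re v + (c * (\<i> * Im v) + Im v *\<^sub>R d))
          = (\<lambda>v. ((s + \<beta>) / 2) * v + ((s - \<beta>) / 2) * cnj v)"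
        by (auto simp: fun_eq_iff \<beta>_def complex_eq_iff field_simps)
      finally have "(log_ext has_derivative (\<lambda>v. ((s + \<beta>) / 2) * v + ((s - \<beta>) / 2) * cnj v)) (at \<zeta>)" .
      moreover have "norm ((s - \<beta>) / 2) \<le> k * norm ((s + \<beta>) / 2)"
        using dil[OF \<beta>] by (simp add: norm_divide)
      ultimately show ?thesis by blast
    qed
  qed
  ultimately show thesis by (rule that)
qed

definition ext :: "complex \<Rightarrow> complex" where
  "ext z = (if z = 0 then 0 else exp (log_ext (Ln z)))"

text \<open>Other branches of the logarithm give the same value, by periodicity. Near a point of the negative
  axis one can therefore compute with a branch that is continuous there.\<close>

lemma ext_exp: "ext (exp \<zeta>) = exp (log_ext \<zeta>)"
proof -
  obtain n :: int where "Ln (exp \<zeta>) = \<zeta> + (of_int (2 * n) * pi) * \<i>"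
    using exp_eq[of "Ln (exp \<zeta>)" \<zeta>] by auto
  then have "Ln (exp \<zeta>) = \<zeta> + of_int n * (2 * pi * \<i>)" by (simp add: mult_ac)
  then have "exp (log_ext (Ln (exp \<zeta>))) = exp (log_ext \<zeta> + of_int n * (2 * pi * \<i>))"
    by (simp only: log_ext_periodic_int)
  also have "\<dots> = exp (log_ext \<zeta>)"
    by (rule iffD2[OF exp_eq]) (rule exI[of _ n], simp add: mult_ac)
  finally show ?thesis by (simp add: ext_def)
qed

lemma ext_eq_f: "z \<in> ball 0 1 \<Longrightarrow> ext z = f z"
proof (cases "z = 0")
  case False
  assume "z \<in> ball 0 1"
  then have "Re (Ln z) < 0" using False by simp
  then show ?thesis using lift[of "Ln z"] False by (simp add: ext_def log_ext_left log_f_def)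
qed (simp add: ext_def f0)

lemma ext_0 [simp]: "ext 0 = 0" and ext_nz: "z \<noteq> 0 \<Longrightarrow> ext z \<noteq> 0"
  by (simp_all add: ext_def)

lemma ext_inj: "inj ext"
proof (rule injI)
  fix x y assume eq: "ext x = ext y"
  show "x = y"
  proof (cases "x = 0 \<or> y = 0")
    case True then show ?thesis using eq ext_nz by (metis ext_0)
  next
    case False
    then have "exp (log_ext (Ln x)) = exp (log_ext (Ln y))" using eq by (simp add: ext_def)
    then obtain n :: int where "log_ext (Ln x) = log_ext (Ln y) + (of_int (2 * n) * pi) * \<i>" using exp_eq by blast
    then have "log_ext (Ln x) = log_ext (Ln y + of_int n * (2 * pi * \<i>))" unfolding log_ext_periodic_int by (simp add: mult_ac)
    then have "Ln x = Ln y + of_int n * (2 * pi * \<i>)" by (rule log_ext_inj)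
    then have "exp (Ln x) = exp (Ln y)" unfolding exp_eq by (intro exI[of _ n]) (simp add: mult_ac)
    then show ?thesis using False by simp
  qed
qed

lemma ext_continuous: "continuous_on UNIV ext"
proof -
  have contG: "continuous_on A log_ext" for A
    using lipschitz_on_continuous_on[OF log_ext_lipschitz] continuous_on_subset by blast
  have "isCont ext z" for z
  proof (cases "z = 0")
    case True
    have "continuous_on (ball 0 1) ext"
      using holomorphic_on_imp_continuous_on[OF f_holo] ext_eq_f continuous_on_cong by blast
    then show ?thesis using True by (simp add: continuous_on_eq_continuous_at)
  next
    case False
    have "isCont (\<lambda>w. exp (log_ext (Ln z + Ln (w / z)))) z"
    proof (rule continuous_exp)
      have "isCont (\<lambda>w. Ln z + Ln (w / z)) z" using False by (intro continuous_intros) auto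
      moreover have "isCont log_ext (Ln z + Ln (z / z))"
        using contG[of UNIV] by (simp add: continuous_on_eq_continuous_at)
      ultimately show "isCont (\<lambda>w. log_ext (Ln z + Ln (w / z))) z" by (rule isCont_o2)
    qed
    moreover have "\<forall>\<^sub>F w in nhds z. exp (log_ext (Ln z + Ln (w / z))) = ext w"
    proof (rule eventually_nhds_in_open[THEN eventually_mono])
      show "open (- {0::complex})" by (rule open_Compl) simp
      show "z \<in> - {0}" using False by simp
      show "exp (log_ext (Ln z + Ln (w / z))) = ext w" if "w \<in> - {0}" for w
        using ext_exp[of "Ln z + Ln (w / z)"] that False by (simp add: exp_add)
    qed
    ultimately show ?thesis by (simp add: isCont_cong)
  qed
  then show ?thesis by (simp add: continuous_on_eq_continuous_at)
qed

text \<open>On the ray through a boundary point the modulus grows like the power \<open>Re s > 0\<close> of the radius, and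
  \<open>ext\<close> is bounded away from zero on the unit circle.\<close>

lemma ext_proper:
  obtains R' where "0 < R'" "\<And>z. norm (ext z) \<le> R \<Longrightarrow> norm z \<le> R'"
proof -
  have "compact (ext ` sphere 0 1)"
    by (intro compact_continuous_image continuous_on_subset[OF ext_continuous]) auto
  moreover have "ext ` sphere 0 1 \<noteq> {}" by auto
  ultimately obtain y where y: "y \<in> ext ` sphere 0 1" "\<forall>x\<in>ext ` sphere 0 1. dist 0 y \<le> dist 0 x"
    using distance_attains_inf[OF compact_imp_closed, of "ext ` sphere 0 1" 0] by metis
  define m where "m = norm y"
  obtain x where x: "x \<in> sphere 0 1" "y = ext x" using y(1) by blast
  then have "x \<noteq> 0" by auto
  then have m: "0 < m" using ext_nz x(2) by (simp add: m_def)
  have low: "m * exp (Re s * Re \<zeta>) \<le> norm (ext (exp \<zeta>))" if "0 \<le> Re \<zeta>" for \<zeta>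
  proof -
    have "exp (log_ext \<zeta>) = exp (s * Re \<zeta>) * exp (log_ext (\<i> * Im \<zeta>))"
      using that by (simp add: log_ext_right exp_add)
    then have "norm (ext (exp \<zeta>)) = exp (Re s * Re \<zeta>) * norm (ext (exp (\<i> * Im \<zeta>)))"
      by (simp add: ext_exp norm_mult norm_exp_eq_Re)
    moreover have "exp (\<i> * Im \<zeta>) \<in> sphere 0 1" by simp
    then have "dist 0 y \<le> dist 0 (ext (exp (\<i> * Im \<zeta>)))" using y(2) by blast
    then have "m \<le> norm (ext (exp (\<i> * Im \<zeta>)))" by (simp add: m_def)
    ultimately show ?thesis by (simp add: mult.commute[of m] mult_left_mono)
  qed
  define R' where "R' = exp (max 0 (ln (max R m / m) / Re s))"
  show thesis
  proof
    fix z assume z: "norm (ext z) \<le> R"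
    show "norm z \<le> R'"
    proof (cases "norm z \<le> 1")
      case True
      also have "1 \<le> R'" by (simp add: R'_def)
      finally show ?thesis .
    next
      case False
      then have nz: "z \<noteq> 0" by auto
      have "m * exp (Re s * ln (norm z)) \<le> max R m"
        using low[of "Ln z"] False nz z by simp
      then have "exp (Re s * ln (norm z)) \<le> max R m / m" using m by (simp add: field_simps)
      then have "Re s * ln (norm z) \<le> ln (max R m / m)"
        using m by (subst ln_ge_iff) auto
      then have "ln (norm z) \<le> ln (max R m / m) / Re s" using Re_s by (simp add: field_simps)
      then have "exp (ln (norm z)) \<le> R'" unfolding R'_def by (simp add: le_max_iff_disj)
      then show ?thesis using nz by simp
    qed
  qed (simp add: R'_def)
qed

text \<open>The range is open by invariance of domain and closed because \<open>ext\<close> is proper.\<close>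

lemma ext_surj: "surj ext"
proof -
  have op: "open (range ext)"
    using invariance_of_domain[OF ext_continuous open_UNIV ext_inj] .
  have "open (- range ext)"
    unfolding open_contains_ball
  proof
    fix y assume y: "y \<in> - range ext"
    obtain R' where R': "\<And>z. norm (ext z) \<le> norm y + 1 \<Longrightarrow> norm z \<le> R'" using ext_proper by blast
    have "compact (ext ` cball 0 R')"
      by (intro compact_continuous_image continuous_on_subset[OF ext_continuous]) auto
    then have "open (- (ext ` cball 0 R') \<inter> ball y 1)" by (intro open_Int open_Compl compact_imp_closed) auto
    moreover have "y \<in> - (ext ` cball 0 R') \<inter> ball y 1" using y by auto
    ultimately obtain e where e: "0 < e" "ball y e \<subseteq> - (ext ` cball 0 R') \<inter> ball y 1"
      unfolding open_contains_ball by blast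
    have "ball y e \<subseteq> - range ext"
    proof (clarify)
      fix z assume z: "ext z \<in> ball y e"
      then have "ext z \<in> ball y 1" using e by blast
      then have "norm (ext z) \<le> norm y + 1"
        using norm_triangle_ineq2[of "ext z" y] by (simp add: dist_norm norm_minus_commute)
      then have "ext z \<in> ext ` cball 0 R'" using R' by (intro imageI) (simp add: dist_norm)
      then show False using e z by blast
    qed
    then show "\<exists>e>0. ball y e \<subseteq> - range ext" using e by blast
  qed
  then have "closed (range ext)" by (simp add: closed_def)
  then show ?thesis using op clopen by blast
qed

end

section \<open>The extension on the sphere\<close>

text \<open>Properness is continuity at infinity. A continuous bijection of a compact Hausdorff space is a
  homeomorphism, so nothing has to be shown about the inverse.\<close>

lemma homeomorphic_map_sphere:
  fixes g :: "complex \<Rightarrow> complex"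
  assumes cont: "continuous_on UNIV g" and inj: "inj g" and surj: "surj g"
    and proper: "\<And>R. \<exists>R'. \<forall>z. norm (g z) \<le> R \<longrightarrow> norm z \<le> R'"
  shows "homeomorphic_map riemann_sphere riemann_sphere (map_option g)"
proof (rule continuous_imp_homeomorphic_map)
  have top: "topspace riemann_sphere = UNIV"
    by (auto simp: riemann_sphere_def UNIV_option_conv)
  show "compact_space riemann_sphere" by (simp add: riemann_sphere_def)
  show "Hausdorff_space riemann_sphere"
    by (simp add: riemann_sphere_def Hausdorff_space_Alexandroff_compactification locally_compact_space_euclidean)
  show "map_option g ` topspace riemann_sphere = topspace riemann_sphere"
  proof -
    have "x \<in> range (map_option g)" for x
    proof (cases x)
      case None
      then show ?thesis by (intro image_eqI[where x = None]) auto
    next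
      case (Some w)
      obtain z where "w = g z" using surj by blast
      then show ?thesis using Some by (intro image_eqI[where x = "Some z"]) auto
    qed
    then show ?thesis by (auto simp: top)
  qed
  show "inj_on (map_option g) (topspace riemann_sphere)"
    using inj by (simp add: top option.inj_map)
  have compact_vimage: "compact (g -` C)" if C: "compact C" for C
  proof -
    obtain R where R: "\<forall>x\<in>C. norm x \<le> R" using compact_imp_bounded[OF C] bounded_iff by blast
    obtain R' where "\<forall>z. norm (g z) \<le> R \<longrightarrow> norm z \<le> R'" using proper by blast
    then have "bounded (g -` C)" using R unfolding bounded_iff by blast
    moreover have "closed (g -` C)"
      using continuous_closed_vimage[of C g] cont compact_imp_closed[OF C]
      by (simp add: continuous_on_eq_continuous_at)
    ultimately show ?thesis by (simp add: compact_eq_bounded_closed)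
  qed
  have open_vimage: "open (g -` V)" if "open V" for V
    using continuous_open_vimage[of V g] cont that by (simp add: continuous_on_eq_continuous_at)
  show "continuous_map riemann_sphere riemann_sphere (map_option g)"
    unfolding continuous_map_def
  proof (intro conjI allI impI)
    fix V assume "openin riemann_sphere V"
    then consider W where "open W" "V = Some ` W" | C where "compact C" "V = insert None (Some ` (- C))"
      by (auto simp: riemann_sphere_def openin_Alexandroff_compactification Compl_eq_Diff_UNIV)
    then show "openin riemann_sphere {x \<in> topspace riemann_sphere. map_option g x \<in> V}"
    proof cases
      case 1
      have "{x \<in> topspace riemann_sphere. map_option g x \<in> V} = Some ` (g -` W)"
        unfolding top 1(2) by (auto simp: image_iff)
      then show ?thesis using open_vimage[OF 1(1)] by (simp add: riemann_sphere_def)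
    next
      case 2
      have "{x \<in> topspace riemann_sphere. map_option g x \<in> V} = insert None (Some ` (- (g -` C)))"
      proof (intro set_eqI)
        fix x show "x \<in> {x \<in> topspace riemann_sphere. map_option g x \<in> V} \<longleftrightarrow> x \<in> insert None (Some ` (- (g -` C)))"
          unfolding top 2(2) by (cases x) auto
      qed
      moreover have "closed (g -` C)" using compact_vimage[OF 2(1)] by (rule compact_imp_closed)
      ultimately show ?thesis using compact_vimage[OF 2(1)]
        by (auto simp: riemann_sphere_def openin_Alexandroff_compactification Compl_eq_Diff_UNIV)
    qed
  qed (simp add: top)
qed

lemma inv_Some [simp]: "inv Some (Some w) = w"
  by (simp add: inv_f_f)

lemma inj_infinity_param: "inj infinity_param"
  by (rule injI) (auto simp: infinity_param_def split: if_splits)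

lemma inv_infinity_param_None [simp]: "inv infinity_param None = 0"
  using inv_f_f[OF inj_infinity_param, of 0] by (simp add: infinity_param_def)

lemma inv_infinity_param_Some [simp]: "w \<noteq> 0 \<Longrightarrow> inv infinity_param (Some w) = 1 / w"
  using inv_f_f[OF inj_infinity_param, of "1 / w"] by (simp add: infinity_param_def)

lemma range_infinity_param: "range infinity_param = - {Some 0}"
proof (intro set_eqI iffI)
  fix x assume "x \<in> - {Some 0 :: complex option}"
  then show "x \<in> range infinity_param"
    by (cases x) (auto simp: infinity_param_def image_iff intro: exI[of _ 0] exI[of _ "1 / y" for y])
qed (auto simp: infinity_param_def split: if_splits)

lemma range_Some: "range Some = - {None}"
  by (auto simp: image_iff)

context half_plane_lift
begin

lemma ext_holomorphic: "ext holomorphic_on ball 0 1"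
  using f_holo by (rule holomorphic_transform) (simp add: ext_eq_f)

text \<open>The coordinate \<open>1 / z\<close> becomes \<open>- \<zeta>\<close> in logarithmic coordinates. The four expressions of the extension in
  the standard coordinates of the sphere have as their lifts the map \<open>log_ext\<close> with a sign in the source,
  in the target, in both or in neither. One criterion thus serves all of them.\<close>

lemma chart_quasiconformal:
  assumes U: "U = UNIV \<or> U = - {0}" and cont: "continuous_on U g" and inj: "inj_on g U"
    and e: "0 < e" "ball p e \<subseteq> U" "g holomorphic_on ball p e"
    and H: "H = log_ext \<or> H = (\<lambda>\<zeta>. - log_ext \<zeta>) \<or> H = (\<lambda>\<zeta>. log_ext (- \<zeta>)) \<or> H = (\<lambda>\<zeta>. - log_ext (- \<zeta>))"
    and g: "\<And>\<zeta>. g (exp \<zeta>) = exp (H \<zeta>)"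
  shows "orientation_preserving_on U g \<and> beltrami_inequality_on k U g"
proof
  have conn: "connected (- {0::complex})"
    using connected_punctured_universe[of "0::complex"] by simp
  have op: "open U" using U by (auto intro: open_Compl)
  then show "orientation_preserving_on U g"
    using U conn cont inj e by (intro orientation_preserving_onI) auto
  obtain E where E: "negligible E" "\<And>\<zeta>. exp \<zeta> \<notin> E \<Longrightarrow>
      \<exists>a b. (log_ext has_derivative (\<lambda>v. a * v + b * cnj v)) (at \<zeta>) \<and> norm b \<le> k * norm a"
    using log_ext_differentiable_ae by blast
  \<comment> \<open>The exceptional set is made to serve both \<open>\<zeta>\<close> and \<open>- \<zeta>\<close>.\<close>
  define E' where "E' = E \<union> inverse ` (E - {0})"
  have "negligible (inverse ` (E - {0}))"
  proof (rule negligible_differentiable_image_negligible)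
    show "negligible (E - {0})" using E(1) by (rule negligible_subset) blast
    show "inverse differentiable_on E - {0}"
    proof (rule differentiable_at_imp_differentiable_on)
      fix z assume "z \<in> E - {0}"
      then show "inverse differentiable at z"
        by (intro differentiable_inverse) auto
    qed
  qed simp
  then have "negligible E'" unfolding E'_def by (intro negligible_Un E(1))
  have neg: "exp (- \<zeta>) \<notin> E" if "exp \<zeta> \<notin> E'" for \<zeta>
  proof
    assume "exp (- \<zeta>) \<in> E"
    then have "exp (- \<zeta>) \<in> E - {0}" by simp
    then have "inverse (exp (- \<zeta>)) \<in> E'" unfolding E'_def by (intro UnI2 imageI)
    then show False using that by (simp add: exp_minus)
  qed
  show "beltrami_inequality_on k U g"
  proof (rule beltrami_inequality_exp_lift[OF op cont g _ \<open>negligible E'\<close>])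
    show "(norm s + (norm c + r))-lipschitz_on UNIV H"
    proof (rule lipschitz_onI)
      fix x y
      show "dist (H x) (H y) \<le> (norm s + (norm c + r)) * dist x y"
        using H lipschitz_onD[OF log_ext_lipschitz, of x y] lipschitz_onD[OF log_ext_lipschitz, of "- x" "- y"]
        by (auto simp: dist_minus)
    qed (use r_nonneg in simp)
    fix \<zeta> assume \<zeta>: "exp \<zeta> \<notin> E'"
    obtain a b where 1: "(log_ext has_derivative (\<lambda>v. a * v + b * cnj v)) (at \<zeta>)" "norm b \<le> k * norm a"
      using E(2)[of \<zeta>] \<zeta> by (auto simp: E'_def)
    obtain a' b' where 2: "(log_ext has_derivative (\<lambda>v. a' * v + b' * cnj v)) (at (- \<zeta>))" "norm b' \<le> k * norm a'"
      using E(2)[OF neg[OF \<zeta>]] by blast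
    have 3: "((\<lambda>\<zeta>. log_ext (- \<zeta>)) has_derivative (\<lambda>v. (- a') * v + (- b') * cnj v)) (at \<zeta>)"
      by (rule has_derivative_eq_rhs, rule has_derivative_compose[where f = uminus and g = log_ext, OF _ 2(1)])
         (auto intro!: derivative_eq_intros)
    have 4: "((\<lambda>\<zeta>. - log_ext \<zeta>) has_derivative (\<lambda>v. (- a) * v + (- b) * cnj v)) (at \<zeta>)"
      by (rule has_derivative_eq_rhs, rule has_derivative_minus[OF 1(1)]) auto
    have 5: "((\<lambda>\<zeta>. - log_ext (- \<zeta>)) has_derivative (\<lambda>v. a' * v + b' * cnj v)) (at \<zeta>)"
      by (rule has_derivative_eq_rhs, rule has_derivative_minus[OF 3]) auto
    show "\<exists>a b. (H has_derivative (\<lambda>v. a * v + b * cnj v)) (at \<zeta>) \<and> norm b \<le> k * norm a"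
      using H
    proof (elim disjE)
      assume "H = log_ext"
      then show ?thesis using 1 by blast
    next
      assume "H = (\<lambda>\<zeta>. - log_ext \<zeta>)"
      then show ?thesis using 4 1(2) by (intro exI[of _ "- a"] exI[of _ "- b"]) simp
    next
      assume "H = (\<lambda>\<zeta>. log_ext (- \<zeta>))"
      then show ?thesis using 3 2(2) by (intro exI[of _ "- a'"] exI[of _ "- b'"]) simp
    next
      assume "H = (\<lambda>\<zeta>. - log_ext (- \<zeta>))"
      then show ?thesis using 5 2(2) by blast
    qed
  qed
qed

lemma ext_quasiconformal: "quasiconformal k (map_option ext)"
  unfolding quasiconformal_def
proof (intro conjI ballI)
  show "homeomorphic_map riemann_sphere riemann_sphere (map_option ext)"
  proof (rule homeomorphic_map_sphere[OF ext_continuous ext_inj ext_surj])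
    fix R
    obtain R' where "\<And>z. norm (ext z) \<le> R \<Longrightarrow> norm z \<le> R'" using ext_proper by blast
    then show "\<exists>R'. \<forall>z. norm (ext z) \<le> R \<longrightarrow> norm z \<le> R'" by blast
  qed
  fix a b assume ab: "a \<in> sphere_params" "b \<in> sphere_params"
  define U where "U = local_rep_domain a b (map_option ext)"
  define g where "g = local_rep a b (map_option ext)"
  have ext0: "ext z = 0 \<longleftrightarrow> z = 0" for z using ext_nz[of z] ext_0 by metis
  have inj: "ext x = ext y \<longleftrightarrow> x = y" for x y using ext_inj by (rule inj_eq)
  have cont: "continuous_on A ext" for A using ext_continuous continuous_on_subset by blast
  have cont_inv: "continuous_on (- {0}) (\<lambda>z. ext (1 / z))"
    by (rule continuous_on_compose2[OF ext_continuous]) (auto intro!: continuous_intros)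
  have holo_inv: "(\<lambda>z. ext (1 / z)) holomorphic_on ball 2 1"
  proof -
    have *: "1 / z \<in> ball 0 1 \<and> z \<noteq> 0" if "z \<in> ball 2 1" for z :: complex
    proof -
      have "norm (2::complex) - norm z \<le> dist 2 z" using norm_triangle_ineq2[of 2 z] by (simp add: dist_norm)
      then have "1 < norm z" using that by simp
      then show ?thesis by (auto simp: norm_divide divide_less_eq)
    qed
    have "(ext \<circ> (\<lambda>z. 1 / z)) holomorphic_on ball 2 1"
      by (rule holomorphic_on_compose_gen[OF _ ext_holomorphic]) (use * in \<open>auto intro!: holomorphic_intros\<close>)
    then show ?thesis by (simp add: o_def)
  qed
  have not0: "0 \<notin> ball (2::complex) 1" "0 \<notin> ball (1/2::complex) (1/2)" by (auto simp: dist_norm)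
  have nz: "z \<in> ball 2 1 \<Longrightarrow> z \<noteq> 0" "z \<in> ball (1/2) (1/2) \<Longrightarrow> z \<noteq> 0" for z :: complex
    using not0 by metis+
  consider "a = Some" "b = Some" | "a = Some" "b = infinity_param"
    | "a = infinity_param" "b = Some" | "a = infinity_param" "b = infinity_param"
    using ab by (auto simp: sphere_params_def)
  then have "orientation_preserving_on U g \<and> beltrami_inequality_on k U g"
  proof cases
    case 1
    have U: "U = UNIV" by (auto simp: U_def local_rep_domain_def 1)
    have g: "g = ext" by (simp add: g_def local_rep_def 1 fun_eq_iff)
    show ?thesis
      by (rule chart_quasiconformal[where p = 0 and e = 1 and H = log_ext])
         (use ext_exp ext_holomorphic cont ext_inj in \<open>auto simp: U g\<close>)
  next
    case 2
    have U: "U = - {0}" by (auto simp: U_def local_rep_domain_def 2 range_infinity_param ext0)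
    have g: "g z = 1 / ext z" if "z \<noteq> 0" for z using that by (simp add: g_def local_rep_def 2 ext0)
    show ?thesis
    proof (rule chart_quasiconformal[where p = "1/2" and e = "1/2" and H = "\<lambda>\<zeta>. - log_ext \<zeta>"])
      have "continuous_on (- {0}) (\<lambda>z. 1 / ext z)" by (intro continuous_intros cont) (auto simp: ext0)
      then show "continuous_on U g" unfolding U using g by (subst continuous_on_cong[OF refl, where g = "\<lambda>z. 1 / ext z"]) auto
      show "inj_on g U" unfolding U by (rule inj_onI) (auto simp: g inj)
      show "ball (1/2) (1/2) \<subseteq> U" unfolding U using not0 by auto
      have "ball (1/2) (1/2) \<subseteq> ball (0::complex) 1" by (subst ball_subset_ball_iff) auto
      then have "ext holomorphic_on ball (1/2) (1/2)" using ext_holomorphic holomorphic_on_subset by blast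
      then have "(\<lambda>z. 1 / ext z) holomorphic_on ball (1/2) (1/2)"
        by (intro holomorphic_on_divide holomorphic_on_const) (simp_all only: ext0 nz not_False_eq_True)
      then show "g holomorphic_on ball (1/2) (1/2)"
        by (rule holomorphic_transform) (simp only: g nz not_False_eq_True)
      show "g (exp \<zeta>) = exp (- log_ext \<zeta>)" for \<zeta> by (simp add: g ext_exp exp_minus divide_inverse)
    qed (auto simp: U)
  next
    case 3
    have U: "U = - {0}" by (auto simp: U_def local_rep_domain_def 3 range_Some infinity_param_def)
    have g: "g z = ext (1 / z)" if "z \<noteq> 0" for z using that by (simp add: g_def local_rep_def 3 infinity_param_def)
    show ?thesis
    proof (rule chart_quasiconformal[where p = 2 and e = 1 and H = "\<lambda>\<zeta>. log_ext (- \<zeta>)"])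
      show "continuous_on U g" unfolding U using g cont_inv
        by (subst continuous_on_cong[OF refl, where g = "\<lambda>z. ext (1 / z)"]) auto
      show "inj_on g U" unfolding U by (rule inj_onI) (auto simp: g inj)
      show "ball 2 1 \<subseteq> U" unfolding U using not0 by auto
      show "g holomorphic_on ball 2 1"
        using holo_inv by (rule holomorphic_transform) (simp only: g nz not_False_eq_True)
      show "g (exp \<zeta>) = exp (log_ext (- \<zeta>))" for \<zeta>
        using ext_exp[of "- \<zeta>"] by (simp add: g exp_minus divide_inverse)
    qed (auto simp: U)
  next
    case 4
    have U: "U = UNIV" unfolding U_def local_rep_domain_def 4 range_infinity_param
      by (auto simp: infinity_param_def ext0)
    have g: "g z = 1 / ext (1 / z)" if "z \<noteq> 0" for z
      using that by (simp add: g_def local_rep_def 4 infinity_param_def ext0)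
    have g0: "g 0 = 0" by (simp add: g_def local_rep_def 4 infinity_param_def)
    show ?thesis
    proof (rule chart_quasiconformal[where p = 2 and e = 1 and H = "\<lambda>\<zeta>. - log_ext (- \<zeta>)"])
      have "continuous_on (- {0}) (\<lambda>z. 1 / ext (1 / z))"
        by (intro continuous_on_divide continuous_on_const cont_inv) (auto simp: ext0)
      then have "continuous_on (- {0}) g" using g by (subst continuous_on_cong[OF refl, where g = "\<lambda>z. 1 / ext (1 / z)"]) auto
      then have "isCont g z" if "z \<noteq> 0" for z using that by (simp add: continuous_on_eq_continuous_at open_Compl)
      moreover have "isCont g 0"
        unfolding continuous_at_eps_delta
      proof (intro allI impI)
        fix \<epsilon> :: real assume \<epsilon>: "0 < \<epsilon>"
        obtain R' where R': "0 < R'" "\<And>z. norm (ext z) \<le> 1 / \<epsilon> \<Longrightarrow> norm z \<le> R'" using ext_proper by blast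
        show "\<exists>d>0. \<forall>x'. dist x' 0 < d \<longrightarrow> dist (g x') (g 0) < \<epsilon>"
        proof (intro exI[of _ "1 / R'"] conjI allI impI)
          fix x :: complex assume x: "dist x 0 < 1 / R'"
          show "dist (g x) (g 0) < \<epsilon>"
          proof (cases "x = 0")
            case False
            have "R' < norm (1 / x)" using x False R'(1) by (simp add: norm_divide field_simps)
            then have "1 / \<epsilon> < norm (ext (1 / x))" using R'(2)[of "1 / x"] by linarith
            moreover have "norm (ext (1 / x)) > 0" using False by (simp add: ext0)
            ultimately show ?thesis using \<epsilon> False by (simp add: g g0 norm_divide field_simps)
          qed (use \<epsilon> in simp)
        qed (use R' in simp)
      qed
      ultimately have "isCont g z" for z by (cases "z = 0") auto
      then show "continuous_on U g" by (simp add: U continuous_on_eq_continuous_at)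
      have "g x = g y \<Longrightarrow> x = y" for x y
        by (cases "x = 0"; cases "y = 0") (auto simp: g g0 inj ext0)
      then show "inj_on g U" by (auto intro: inj_onI)
      have "(\<lambda>z. 1 / ext (1 / z)) holomorphic_on ball 2 1"
        by (intro holomorphic_on_divide holomorphic_on_const holo_inv) (simp add: ext0 nz(1))
      then show "g holomorphic_on ball 2 1"
        by (rule holomorphic_transform) (simp only: g nz not_False_eq_True)
      show "g (exp \<zeta>) = exp (- log_ext (- \<zeta>))" for \<zeta>
        using ext_exp[of "- \<zeta>"] by (simp add: g exp_minus divide_inverse)
    qed (auto simp: U)
  qed
  then show "orientation_preserving_on (local_rep_domain a b (map_option ext)) (local_rep a b (map_option ext))"
    "beltrami_inequality_on k (local_rep_domain a b (map_option ext)) (local_rep a b (map_option ext))"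
    by (auto simp: U_def g_def)
qed

end

theorem corollary5p9:
  fixes k K :: real and f :: "complex \<Rightarrow> complex"
  assumes k: "0 \<le> k" "k < 1"
    and K: "K = (1 + k) / (1 - k)"
    and holo: "f holomorphic_on ball 0 1"
    and f0: "f 0 = 0"
    and df0: "deriv f 0 \<noteq> 0"
    and disk: "\<exists>B c r. 0 \<le> r \<and> B = cball c r \<and> B \<subseteq> - {0} \<and>
          (\<forall>w\<in>B. \<forall>z\<in>B. sqrt (cmod (w / z)) \<le> K) \<and>
          (\<forall>z\<in>ball 0 1 - {0}. f z \<noteq> 0 \<and> z * deriv f z / f z \<in> B)"
  shows "has_qc_extension_fixing_infinity k f"
proof -
  obtain c r where r: "0 \<le> r" and sub: "cball c r \<subseteq> - {0}"
    and ratio: "\<forall>w\<in>cball c r. \<forall>z\<in>cball c r. sqrt (cmod (w / z)) \<le> K"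
    and B: "\<And>z. z \<in> ball 0 1 - {0} \<Longrightarrow> f z \<noteq> 0 \<and> z * deriv f z / f z \<in> cball c r"
    using disk by blast
  obtain s where s: "\<And>\<beta>. \<beta> \<in> cball c r \<Longrightarrow> norm (s - \<beta>) \<le> k * norm (s + \<beta>)"
    "\<And>\<beta>. \<beta> \<in> cball c r \<Longrightarrow> 0 < Re (cnj s * \<beta>)"
    by (rule disk_apollonius_center[OF k r disk_modulus_ratio[OF k K r sub ratio]], rule that)
  obtain h where h: "r-lipschitz_on {\<zeta>. Re \<zeta> \<le> 0} h" "h holomorphic_on {\<zeta>. Re \<zeta> < 0}"
    "\<And>\<zeta>. Re \<zeta> < 0 \<Longrightarrow> exp (c * \<zeta> + h \<zeta>) = f (exp \<zeta>)"
    "\<And>\<zeta>. Re \<zeta> \<le> 0 \<Longrightarrow> h (\<zeta> + 2 * pi * \<i>) = h \<zeta> + 2 * pi * \<i> * (1 - c)"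
    "1 \<in> cball c r"
    by (rule logarithmic_lift[OF holo f0 df0 r B], assumption, rule that)
  interpret half_plane_lift c s r k h f
    by unfold_locales (use h s k holo f0 in auto)
  show ?thesis
    unfolding has_qc_extension_fixing_infinity_def
    using ext_quasiconformal ext_eq_f by (intro exI[of _ "map_option ext"]) auto
qed

end
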